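(* Let $k,r\geq 1$ be fixed integers. Then the List-$k$-Coloring Problem restricted to $rP_3$-free graphs can be solved in polynomial time.
   Context: Graphs have finite vertex sets, no loops and no parallel edges. For an integer $k\geq 1$, write $[k]=\{1,\ldots,k\}$. An induced subgraph of a graph $G$ is a graph obtained from $G$ by removing the vertices in some set $X\subseteq V(G)$. A graph $G$ contains a graph $H$ if $H$ is isomorphic to an induced subgraph of $G$; otherwise $G$ is $H$-free. For integers $r,s\geq 1$, $P_s$ denotes the path on $s$ vertices and $rP_s$ denotes the disjoint union of $r$ copies of $P_s$. A proper $k$-coloring of $G$ is a map $\varphi:V(G)\rightarrow[k]$ such that $\varphi(u)\neq\varphi(v)$ for every edge $uv\in E(G)$. A list-$k$-assignment for $G$ is a map $L:V(G)\rightarrow 2^{[k]}$. An $L$-coloring of $G$ is a proper $k$-coloring $\varphi$ of $G$ such that $\varphi(v)\in L(v)$ for all $v\in V(G)$. The List-$k$-Coloring Problem is to decide, given a graph $G$ and a list-$k$-assignment $L$ for $G$, whether $G$ admits an $L$-coloring. Its restriction to $H$-free graphs is the problem where the input graph $G$ is required to be $H$-free. Since $k$ and $r$ are fixed, the polynomial bounding the running time may depend on $k$ and $r$. *)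

theory Defs
  imports "Graph_Theory.Graph_Theory" "HOL-Computational_Algebra.Polynomial"
begin

section \<open>Graphs\<close>

text \<open>
  A finite simple graph is an element of type \<^typ>\<open>'a pair_pre_digraph\<close> satisfying
  \<^const>\<open>pair_graph\<close>: an edge \<open>uv\<close> is present as the two arcs \<open>(u, v)\<close> and \<open>(v, u)\<close>.
\<close>

definition contains :: "'a pair_pre_digraph \<Rightarrow> 'b pair_pre_digraph \<Rightarrow> bool" where
  "contains G H \<longleftrightarrow>
     (\<exists>G'. induced_subgraph (with_proj G') (with_proj G) \<and>
           digraph_iso (with_proj H) (with_proj G'))"

abbreviation is_free :: "'b pair_pre_digraph \<Rightarrow> 'a pair_pre_digraph \<Rightarrow> bool" where
  "is_free H G \<equiv> \<not> contains G H"

definition path_graph :: "nat \<Rightarrow> nat pair_pre_digraph" where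
  "path_graph s =
     \<lparr> pverts = {1..s},
       parcs = {(i, j). i \<in> {1..s} \<and> j \<in> {1..s} \<and> (j = i + 1 \<or> i = j + 1)} \<rparr>"

definition copies :: "nat \<Rightarrow> 'a pair_pre_digraph \<Rightarrow> (nat \<times> 'a) pair_pre_digraph" where
  "copies r H =
     \<lparr> pverts = {1..r} \<times> pverts H,
       parcs = {((i, u), (j, v)). i \<in> {1..r} \<and> i = j \<and> (u, v) \<in> parcs H} \<rparr>"

section \<open>List colorings\<close>

definition proper_coloring :: "nat \<Rightarrow> 'a pair_pre_digraph \<Rightarrow> ('a \<Rightarrow> nat) \<Rightarrow> bool" where
  "proper_coloring k G \<phi> \<longleftrightarrow>
     (\<forall>v \<in> pverts G. \<phi> v \<in> {1..k}) \<and> (\<forall>(u, v) \<in> parcs G. \<phi> u \<noteq> \<phi> v)"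

definition list_assignment :: "nat \<Rightarrow> 'a pair_pre_digraph \<Rightarrow> ('a \<Rightarrow> nat set) \<Rightarrow> bool" where
  "list_assignment k G L \<longleftrightarrow> (\<forall>v \<in> pverts G. L v \<subseteq> {1..k})"

definition list_coloring ::
    "nat \<Rightarrow> 'a pair_pre_digraph \<Rightarrow> ('a \<Rightarrow> nat set) \<Rightarrow> ('a \<Rightarrow> nat) \<Rightarrow> bool" where
  "list_coloring k G L \<phi> \<longleftrightarrow> proper_coloring k G \<phi> \<and> (\<forall>v \<in> pverts G. \<phi> v \<in> L v)"

section \<open>Polynomial time\<close>

text \<open>
  The machine model is the random access machine with addition and truncated subtraction
  under the uniform cost measure, which is polynomially equivalent to Turing machines:
  one step makes the largest stored number at most twice as large, so after \<open>t\<close> steps all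
  numbers have bit length at most linear in \<open>t\<close> and in the bit length of the largest number
  in the program and the initial state. (Multiplication as a unit cost instruction would
  destroy this.) Control flow is structured instead of by jumps; a jumping program
  is a single loop around a case distinction on a program counter register, and so
  running times change only by a constant factor depending on the program.

  A program mentions finitely many registers, addressed directly; the
  memory is unbounded and addressed indirectly through registers.
\<close>

type_synonym state = "(nat \<Rightarrow> nat) \<times> (nat \<Rightarrow> nat)"  (* registers, memory *)

datatype ram =
    SetConst nat nat
  | Plus nat nat nat
  | Minus nat nat nat
  | Read nat nat
  | Write nat nat
  | Seq ram ram
  | IfNZ nat ram ram
  | WhileNZ nat ram

text \<open>\<open>exec c s t s'\<close>: started in state \<open>s\<close>, program \<open>c\<close> halts after \<open>t\<close> steps in state \<open>s'\<close>.\<close>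

inductive exec :: "ram \<Rightarrow> state \<Rightarrow> nat \<Rightarrow> state \<Rightarrow> bool" where
  SetConst: "exec (SetConst x n) (R, M) 1 (R(x := n), M)"
| Plus: "exec (Plus x y z) (R, M) 1 (R(x := R y + R z), M)"
| Minus: "exec (Minus x y z) (R, M) 1 (R(x := R y - R z), M)"
| Read: "exec (Read x y) (R, M) 1 (R(x := M (R y)), M)"
| Write: "exec (Write x y) (R, M) 1 (R, M(R x := R y))"
| Seq: "exec c\<^sub>1 s t\<^sub>1 s' \<Longrightarrow> exec c\<^sub>2 s' t\<^sub>2 s'' \<Longrightarrow> exec (Seq c\<^sub>1 c\<^sub>2) s (t\<^sub>1 + t\<^sub>2) s''"
| IfTrue: "fst s x \<noteq> 0 \<Longrightarrow> exec c\<^sub>1 s t s' \<Longrightarrow> exec (IfNZ x c\<^sub>1 c\<^sub>2) s (1 + t) s'"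
| IfFalse: "fst s x = 0 \<Longrightarrow> exec c\<^sub>2 s t s' \<Longrightarrow> exec (IfNZ x c\<^sub>1 c\<^sub>2) s (1 + t) s'"
| WhileTrue: "fst s x \<noteq> 0 \<Longrightarrow> exec c s t\<^sub>1 s' \<Longrightarrow> exec (WhileNZ x c) s' t\<^sub>2 s'' \<Longrightarrow>
    exec (WhileNZ x c) s (1 + t\<^sub>1 + t\<^sub>2) s''"
| WhileFalse: "fst s x = 0 \<Longrightarrow> exec (WhileNZ x c) s 1 s"

lemma exec_deterministic:
  "exec c s t s' \<Longrightarrow> exec c s u s'' \<Longrightarrow> t = u \<and> s' = s''"
proof (induction arbitrary: u s'' rule: exec.induct)
  case (Seq c\<^sub>1 s t\<^sub>1 s' c\<^sub>2 t\<^sub>2 s2)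
  from Seq.prems show ?case by (cases rule: exec.cases) (use Seq.IH in blast)
next
  case (WhileTrue s x c t\<^sub>1 s' t\<^sub>2 s2)
  from WhileTrue.prems show ?case
    by (cases rule: exec.cases) (use WhileTrue.IH WhileTrue.hyps in blast)+
qed (erule exec.cases; auto)+

text \<open>
  The input, a bit string, is placed in the memory and its length in register 0. All other
  registers and memory cells are 0.
\<close>

definition initial_state :: "bool list \<Rightarrow> state" where
  "initial_state xs =
     ((\<lambda>x. if x = 0 then length xs else 0),
      (\<lambda>i. if i < length xs \<and> xs ! i then 1 else 0))"

text \<open>
  Deciding \<open>Q\<close> on the set \<open>I\<close> of instances, encoded by \<open>enc\<close>, in polynomial time.
  The answer is yes iff register 0 is nonzero at the end. Nothing is
  required on bit strings that do not encode an element of \<open>I\<close>.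
\<close>

definition poly_time_decidable :: "('i \<Rightarrow> bool list) \<Rightarrow> 'i set \<Rightarrow> ('i \<Rightarrow> bool) \<Rightarrow> bool" where
  "poly_time_decidable enc I Q \<longleftrightarrow>
     (\<exists>(c :: ram) (p :: nat poly). \<forall>x \<in> I. \<exists>t R M.
        exec c (initial_state (enc x)) t (R, M) \<and>
        t \<le> poly p (length (enc x)) \<and>
        (R 0 \<noteq> 0 \<longleftrightarrow> Q x))"

section \<open>The List-k-Coloring Problem\<close>

text \<open>
  Vertices of input graphs are natural numbers. The encoding of \<open>(G, L)\<close> is
  \<open>|V(G)|\<close> in unary, followed by the adjacency matrix and by the characteristic
  vectors of length \<open>k\<close> of the lists, with the vertices taken in increasing order.
\<close>

type_synonym list_instance = "nat pair_pre_digraph \<times> (nat \<Rightarrow> nat set)"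

definition encode :: "nat \<Rightarrow> list_instance \<Rightarrow> bool list" where
  "encode k = (\<lambda>(G, L). let vs = sorted_list_of_set (pverts G) in
     replicate (length vs) True @ [False] @
     [(u, v) \<in> parcs G. u \<leftarrow> vs, v \<leftarrow> vs] @
     [c \<in> L v. v \<leftarrow> vs, c \<leftarrow> [1..<k + 1]])"

definition list_coloring_instances :: "nat \<Rightarrow> list_instance set" where
  "list_coloring_instances k = {(G, L). pair_graph G \<and> list_assignment k G L}"

definition has_list_coloring :: "nat \<Rightarrow> list_instance \<Rightarrow> bool" where
  "has_list_coloring k = (\<lambda>(G, L). \<exists>\<phi>. list_coloring k G L \<phi>)"

definition list_coloring_poly_time_on_free :: "nat \<Rightarrow> 'a pair_pre_digraph \<Rightarrow> bool" where
  "list_coloring_poly_time_on_free k H \<longleftrightarrow>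
     poly_time_decidable (encode k)
       {(G, L) \<in> list_coloring_instances k. is_free H G} (has_list_coloring k)"

end

theory Submission
  imports Defs
begin

text \<open>
  Let \<open>I\<close> be a color class of a coloring of an \<open>rP\<^sub>3\<close>-free graph. A bounded set \<open>T \<subseteq> I\<close> can be chosen
  such that every vertex outside \<open>I\<close> without a neighbor in \<open>T\<close> has at most one neighbor in \<open>I\<close>. Let
  \<open>X\<close> be the vertex set of a maximal family of pairwise anticomplete induced \<open>P\<^sub>3\<close>'s in \<open>V - N(T)\<close> and
  add to \<open>T\<close> the boundedly many vertices of \<open>I\<close> in \<open>N[X]\<close>. Then \<open>I\<close> is contained in
  \<open>V - N(T) - (N[X] - T)\<close>, and this set is \<open>P\<^sub>3\<close>-free: by maximality, an induced \<open>P\<^sub>3\<close> would meet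
  \<open>N[X]\<close>, hence \<open>T\<close>, whose vertices are isolated there.

  So after guessing \<open>T\<close> and \<open>X\<close> for every color and restricting the lists accordingly, the vertices
  having a given color in their lists induce a disjoint union of cliques. Such an instance is a
  bipartite matching problem between vertices and pairs of a color and a clique. It is
  solved by an auction: an uncolored vertex takes the cheapest color of its list, uncolors the
  neighbors of that color, and raises the price of that color on the clique by one.
  If a coloring exists, prices never exceed \<open>n\<close>, so \<open>n\<^sup>2\<close> rounds suffice. A wrong guess does no
  harm, because the auction only ever produces partial list colorings.
\<close>

section \<open>Induced three-vertex paths and color classes\<close>

type_synonym 'a rel2 = "'a \<Rightarrow> 'a \<Rightarrow> bool"

definition nbrs :: "'a rel2 \<Rightarrow> 'a \<Rightarrow> 'a set \<Rightarrow> 'a set" where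
  "nbrs E v W = {u \<in> W. E v u}"

definition stable :: "'a rel2 \<Rightarrow> 'a set \<Rightarrow> bool" where
  "stable E W \<longleftrightarrow> (\<forall>u\<in>W. \<forall>v\<in>W. \<not> E u v)"

definition induced_P3 :: "'a rel2 \<Rightarrow> 'a \<times> 'a \<times> 'a \<Rightarrow> bool" where
  "induced_P3 E = (\<lambda>(a, b, c). E a b \<and> E b c \<and> \<not> E a c \<and> a \<noteq> c)"

definition path_verts :: "'a \<times> 'a \<times> 'a \<Rightarrow> 'a set" where
  "path_verts = (\<lambda>(a, b, c). {a, b, c})"

definition anticomplete :: "'a rel2 \<Rightarrow> 'a set \<Rightarrow> 'a set \<Rightarrow> bool" where
  "anticomplete E A B \<longleftrightarrow> (\<forall>a\<in>A. \<forall>b\<in>B. a \<noteq> b \<and> \<not> E a b)"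

text \<open>For symmetric irreflexive \<open>E\<close> such a list is an induced copy of the
  disjoint union of \<open>length ts\<close> paths. In a list the number of paths is the length, and
  \<open>sorted_wrt\<close> asks for each pair once.\<close>

definition P3_family :: "'a rel2 \<Rightarrow> 'a set \<Rightarrow> ('a \<times> 'a \<times> 'a) list \<Rightarrow> bool" where
  "P3_family E W ts \<longleftrightarrow> (\<forall>t\<in>set ts. induced_P3 E t \<and> path_verts t \<subseteq> W) \<and>
     sorted_wrt (\<lambda>s t. anticomplete E (path_verts s) (path_verts t)) ts"

text \<open>For symmetric irreflexive \<open>E\<close> this means that \<open>W\<close> induces a
  disjoint union of cliques.\<close>

definition P3_free :: "'a rel2 \<Rightarrow> 'a set \<Rightarrow> bool" where
  "P3_free E W \<longleftrightarrow> (\<forall>a\<in>W. \<forall>b\<in>W. \<forall>c\<in>W. E a b \<longrightarrow> E b c \<longrightarrow> a \<noteq> c \<longrightarrow> E a c)"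

lemma P3_family_mono: "P3_family E W ts \<Longrightarrow> W \<subseteq> W' \<Longrightarrow> P3_family E W' ts"
  unfolding P3_family_def by blast

lemma P3_family_Cons:
  "P3_family E W (t # ts) \<longleftrightarrow> induced_P3 E t \<and> path_verts t \<subseteq> W \<and>
     (\<forall>s\<in>set ts. anticomplete E (path_verts t) (path_verts s)) \<and> P3_family E W ts"
  unfolding P3_family_def by auto

lemma P3_free_mono: "P3_free E W \<Longrightarrow> W' \<subseteq> W \<Longrightarrow> P3_free E W'"
  unfolding P3_free_def by blast

text \<open>
  Take \<open>v\<close> with the fewest neighbors in \<open>I\<close>, at least two, and put two of them into \<open>T\<close>. A vertex of
  \<open>J\<close> missed by these two has at least two neighbors in \<open>I\<close> outside \<open>N(v)\<close>, by minimality;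
  the path through \<open>v\<close> is anticomplete to the rest, so the induction applies there.
\<close>

lemma hitting_set:
  assumes sym: "\<And>u v. E u v \<Longrightarrow> E v u"
    and "finite I" "finite J" "stable E I" "stable E J" "I \<inter> J = {}"
    and "\<And>ts. P3_family E (I \<union> J) ts \<Longrightarrow> length ts \<le> r"
  shows "\<exists>T \<subseteq> I. card T \<le> 2 * r \<and> (\<forall>v\<in>J. card (nbrs E v I) \<ge> 2 \<longrightarrow> nbrs E v T \<noteq> {})"
  using assms(2-)
proof (induction r arbitrary: I J)
  case 0
  have "\<not> card (nbrs E v I) \<ge> 2" if v: "v \<in> J" for v
  proof
    assume "card (nbrs E v I) \<ge> 2"
    then obtain a b where ab: "a \<in> nbrs E v I" "b \<in> nbrs E v I" "a \<noteq> b"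
      by (meson card_2_iff' obtain_subset_with_card_n subsetD)
    have "P3_family E (I \<union> J) [(a, v, b)]"
      using ab v sym 0(3) by (auto simp: P3_family_def induced_P3_def path_verts_def nbrs_def stable_def)
    from "0.prems"(6)[OF this] show False by simp
  qed
  then show ?case by (intro exI[of _ "{}"]) auto
next
  case (Suc r)
  show ?case
  proof (cases "\<exists>v\<in>J. card (nbrs E v I) \<ge> 2")
    case False
    then show ?thesis by (intro exI[of _ "{}"]) auto
  next
    case True
    define d where "d v = card (nbrs E v I)" for v
    obtain v where v: "v \<in> J" "d v \<ge> 2" and vmin: "\<And>w. w \<in> J \<Longrightarrow> d w \<ge> 2 \<Longrightarrow> d v \<le> d w"
    proof -
      from True have "\<exists>v. v \<in> J \<and> d v \<ge> 2" by (auto simp: d_def)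
      then show ?thesis using that
          ex_has_least_nat[of "\<lambda>v. v \<in> J \<and> d v \<ge> 2" _ d] by blast
    qed
    obtain a b where ab: "a \<in> nbrs E v I" "b \<in> nbrs E v I" "a \<noteq> b"
      using v(2) unfolding d_def by (meson card_2_iff' obtain_subset_with_card_n subsetD)
    define I' where "I' = I - nbrs E v I"
    define J' where "J' = {w\<in>J. \<not> E w a \<and> \<not> E w b}"
    have fin: "finite (nbrs E w K)" if "finite K" for w and K :: "'a set" using that by (auto simp: nbrs_def)
    have sub: "I' \<subseteq> I" "J' \<subseteq> J" by (auto simp: I'_def J'_def)
    have "length ts \<le> r" if ts: "P3_family E (I' \<union> J') ts" for ts
    proof -
      have "anticomplete E (path_verts (a, v, b)) (I' \<union> J')"
        using ab v Suc.prems(3,4,5) sym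
        unfolding anticomplete_def path_verts_def I'_def J'_def nbrs_def stable_def by auto
      moreover have "\<forall>s\<in>set ts. path_verts s \<subseteq> I' \<union> J'" using ts by (auto simp: P3_family_def)
      ultimately have "\<forall>s\<in>set ts. anticomplete E (path_verts (a, v, b)) (path_verts s)"
        unfolding anticomplete_def by blast
      moreover have "induced_P3 E (a, v, b)" "path_verts (a, v, b) \<subseteq> I \<union> J"
        using ab v sym Suc.prems(3) by (auto simp: induced_P3_def path_verts_def nbrs_def stable_def)
      ultimately have "P3_family E (I \<union> J) ((a, v, b) # ts)"
        using P3_family_mono[OF ts, of "I \<union> J"] sub by (auto simp: P3_family_Cons)
      from Suc.prems(6)[OF this] show ?thesis by simp
    qed
    moreover have "finite I'" "finite J'" "stable E I'" "stable E J'" "I' \<inter> J' = {}"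
      using Suc.prems(1-5) sub unfolding stable_def by (meson finite_subset subsetD, meson finite_subset, blast+)
    ultimately obtain T
      where T: "T \<subseteq> I'" "card T \<le> 2 * r" "\<And>w. w \<in> J' \<Longrightarrow> card (nbrs E w I') \<ge> 2 \<Longrightarrow> nbrs E w T \<noteq> {}"
      using Suc.IH[of I' J'] by blast
    show ?thesis
    proof (intro exI[of _ "insert a (insert b T)"] conjI ballI impI)
      show "insert a (insert b T) \<subseteq> I" using ab T(1) sub by (auto simp: nbrs_def)
      show "card (insert a (insert b T)) \<le> 2 * Suc r"
        using T(2) card_insert_le_m1[of "2 * r + 2" "insert b T" a] card_insert_le_m1[of "2 * r + 1" T b]
        by simp
      fix w assume w: "w \<in> J" "2 \<le> card (nbrs E w I)"
      show "nbrs E w (insert a (insert b T)) \<noteq> {}"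
      proof (cases "w \<in> J'")
        case False
        then show ?thesis using w by (auto simp: J'_def nbrs_def)
      next
        case True
        \<comment> \<open>In the passage to \<open>I'\<close> the vertex \<open>w\<close> loses only
          common neighbors with \<open>v\<close>, and neither \<open>a\<close> nor \<open>b\<close>
          is one. So at most \<open>d v - 2\<close>, hence at most \<open>d w - 2\<close>, are lost
          and two remain.\<close>
        have "nbrs E w I - nbrs E w I' \<subseteq> nbrs E v I - {a, b}"
          using True by (auto simp: nbrs_def I'_def J'_def)
        moreover have "card (nbrs E v I - {a, b}) = d v - 2"
          using ab by (subst card_Diff_subset) (auto simp: d_def)
        ultimately have "card (nbrs E w I - nbrs E w I') \<le> d v - 2"
          by (metis card_mono fin finite_Diff Suc.prems(1))
        moreover have "card (nbrs E w I - nbrs E w I') = d w - card (nbrs E w I')"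
          using sub by (subst card_Diff_subset)
            (auto simp: d_def fin finite_subset[OF sub(1) Suc.prems(1)] nbrs_def)
        moreover have "d v \<le> d w" using vmin w by (simp add: d_def)
        ultimately have "card (nbrs E w I') \<ge> 2" using v(2) by linarith
        from T(3)[OF True this] show ?thesis by (auto simp: nbrs_def)
      qed
    qed
  qed
qed

section \<open>Containers for color classes\<close>

definition container :: "'a rel2 \<Rightarrow> 'a set \<Rightarrow> 'a set \<Rightarrow> 'a set \<Rightarrow> 'a set" where
  "container E V T X = {u \<in> V. (\<forall>t\<in>T. \<not> E u t) \<and> (u \<in> T \<or> (\<forall>x\<in>X. u \<noteq> x \<and> \<not> E u x))}"

text \<open>The bound for \<open>T\<close> collects \<open>2 * r\<close> vertices for each color, at
  most one vertex of the class for each of the \<open>3 * r\<close> vertices of the maximal family,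
  and one vertex that makes the set nonempty. A common bound for \<open>T\<close> and
  \<open>X\<close> gives guesses of uniform length.\<close>

lemma color_class_container:
  fixes \<phi> :: "'a \<Rightarrow> nat"
  assumes sym: "\<And>u v. E u v \<Longrightarrow> E v u" and irrefl: "\<And>u. \<not> E u u"
    and fin: "finite V" and ne: "V \<noteq> {}"
    and col: "\<And>v. v \<in> V \<Longrightarrow> \<phi> v \<in> {1..k}"
      "\<And>u v. u \<in> V \<Longrightarrow> v \<in> V \<Longrightarrow> E u v \<Longrightarrow> \<phi> u \<noteq> \<phi> v"
    and free: "\<And>ts. P3_family E V ts \<Longrightarrow> length ts \<le> r"
  obtains T X where "T \<subseteq> V" "X \<subseteq> V" "T \<noteq> {}" "X \<noteq> {}"
    "card T \<le> 2 * r * k + 3 * r + 1" "card X \<le> 2 * r * k + 3 * r + 1"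
    "{v \<in> V. \<phi> v = c} \<subseteq> container E V T X" "P3_free E (container E V T X)"
proof -
  define I where "I = {v \<in> V. \<phi> v = c}"
  define J where "J d = {v \<in> V. \<phi> v = d}" for d
  have finI: "finite I" and IV: "I \<subseteq> V" using fin by (auto simp: I_def)
  \<comment> \<open>Another color class is stable and disjoint from \<open>I\<close>, so
    \<open>hitting_set\<close> applies to the pair. The vertices of color \<open>d\<close> with at
    least two neighbors in \<open>I\<close> are caught by \<open>S d\<close>.\<close>
  have "\<exists>T \<subseteq> I. card T \<le> 2 * r \<and>
      (\<forall>v\<in>J d. card (nbrs E v I) \<ge> 2 \<longrightarrow> nbrs E v T \<noteq> {})" if "d \<noteq> c" for d
  proof (rule hitting_set[OF sym])
    show "length ts \<le> r" if "P3_family E (I \<union> J d) ts" for ts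
      using free[OF P3_family_mono[OF that]] by (auto simp: I_def J_def)
  qed (use that fin in \<open>auto simp: I_def J_def stable_def dest: col(2)\<close>)
  then obtain S where S: "\<And>d. d \<noteq> c \<Longrightarrow> S d \<subseteq> I" "\<And>d. d \<noteq> c \<Longrightarrow> card (S d) \<le> 2 * r"
    "\<And>d v. d \<noteq> c \<Longrightarrow> v \<in> J d \<Longrightarrow> card (nbrs E v I) \<ge> 2 \<Longrightarrow> nbrs E v (S d) \<noteq> {}"
    by metis
  define T0 where "T0 = (\<Union>d\<in>{1..k} - {c}. S d)"
  have T0I: "T0 \<subseteq> I" using S(1) by (auto simp: T0_def)
  have "card T0 \<le> (\<Sum>d\<in>{1..k} - {c}. card (S d))"
    unfolding T0_def by (rule card_UN_le) simp
  also have "\<dots> \<le> card ({1..k} - {c}) * (2 * r)"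
    using sum_bounded_above[of "{1..k} - {c}" "\<lambda>d. card (S d)" "2 * r"] S(2) by simp
  also have "\<dots> \<le> k * (2 * r)"
    using card_mono[of "{1..k}" "{1..k} - {c}"] by simp
  finally have cT0: "card T0 \<le> 2 * r * k" by (simp add: mult.commute)
  have few: "card (nbrs E v I) \<le> 1" if "v \<in> V" "v \<notin> I" "\<And>t. t \<in> T0 \<Longrightarrow> \<not> E v t" for v
  proof (rule ccontr)
    assume *: "\<not> card (nbrs E v I) \<le> 1"
    have d: "\<phi> v \<noteq> c" "v \<in> J (\<phi> v)" "\<phi> v \<in> {1..k} - {c}"
      using that(1,2) col(1)[OF that(1)] by (auto simp: I_def J_def)
    from S(3)[OF d(1,2)] * have "nbrs E v (S (\<phi> v)) \<noteq> {}" by simp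
    then show False using that(3) d(3) unfolding nbrs_def T0_def by blast
  qed
  define W where "W = {v \<in> V. \<forall>t\<in>T0. \<not> E v t}"
  have WV: "W \<subseteq> V" by (auto simp: W_def)
  have "P3_family E W []" by (simp add: P3_family_def)
  moreover have "\<forall>us. P3_family E W us \<longrightarrow> length us < Suc r"
    using free[OF P3_family_mono[OF _ WV]] by (simp add: less_Suc_eq_le)
  ultimately obtain ts where ts: "P3_family E W ts"
    and tsmax: "\<And>us. P3_family E W us \<Longrightarrow> length us \<le> length ts"
    using ex_has_greatest_nat[of "P3_family E W" "[]" length "Suc r"] by blast
  have len: "length ts \<le> r" by (rule free[OF P3_family_mono[OF ts WV]])
  define X where "X = (\<Union>t\<in>set ts. path_verts t)"
  have XW: "X \<subseteq> W" using ts by (auto simp: X_def P3_family_def)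
  have finX: "finite X" by (auto simp: X_def path_verts_def)
  have "card X \<le> (\<Sum>t\<in>set ts. card (path_verts t))" unfolding X_def by (rule card_UN_le) simp
  also have "\<dots> \<le> card (set ts) * 3"
    by (rule order_trans[OF sum_bounded_above[of _ _ 3]])
      (auto simp: path_verts_def intro!: card_insert_le_m1)
  also have "\<dots> \<le> r * 3" using len card_length[of ts] by simp
  finally have cX: "card X \<le> 3 * r" by (simp add: mult.commute)
  define N where "N x = insert x (nbrs E x V) \<inter> I" for x
  define T1 where "T1 = T0 \<union> (\<Union>x\<in>X. N x)"
  have T1I: "T1 \<subseteq> I" using T0I by (auto simp: T1_def N_def)
  \<comment> \<open>A vertex of \<open>X\<close> in the class has no neighbor there. Any other one
    misses \<open>T0\<close>, as \<open>X\<close> lies in \<open>W\<close>, and has at most one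
    neighbor in the class by \<open>few\<close>.\<close>
  have cN: "card (N x) \<le> 1" if "x \<in> X" for x
  proof (cases "x \<in> I")
    case True
    then have "N x \<subseteq> {x}" by (auto simp: N_def nbrs_def I_def dest: col(2))
    then show ?thesis using card_mono[of "{x}" "N x"] by simp
  next
    case False
    then have "N x = nbrs E x I" using IV by (auto simp: N_def nbrs_def)
    then show ?thesis using few[of x] False that XW by (auto simp: W_def)
  qed
  have "card (\<Union>x\<in>X. N x) \<le> (\<Sum>x\<in>X. card (N x))" by (rule card_UN_le[OF finX])
  also have "\<dots> \<le> card X" using sum_bounded_above[of X "\<lambda>x. card (N x)" 1] cN by simp
  finally have cT1: "card T1 \<le> 2 * r * k + 3 * r"
    using cX cT0 card_Un_le[of T0 "\<Union>x\<in>X. N x"] by (simp add: T1_def)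
  \<comment> \<open>\<open>t\<close> makes \<open>T\<close> and \<open>Y\<close> nonempty. It is
    taken from \<open>I\<close> if possible, so that \<open>T\<close> stays inside \<open>I\<close>;
    for empty \<open>I\<close> the inclusion \<open>incl\<close> is vacuous.\<close>
  obtain t where tV: "t \<in> V" and tI: "I = {} \<or> t \<in> I" using ne IV by blast
  define T where "T = insert t T1"
  define Y where "Y = insert t X"
  have incl: "I \<subseteq> container E V T Y"
  proof
    fix u assume u: "u \<in> I"
    have TI: "T \<subseteq> I" using T1I tI u by (auto simp: T_def)
    have 1: "\<forall>s\<in>T. \<not> E u s" using TI u col(2)[of u] unfolding I_def by fastforce
    moreover have "u \<in> T \<or> (\<forall>x\<in>Y. u \<noteq> x \<and> \<not> E u x)"
    proof (cases "u \<in> T")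
      case False
      have "u \<noteq> x \<and> \<not> E u x" if "x \<in> X" for x
        using False that u IV sym by (auto simp: T_def T1_def N_def nbrs_def)
      moreover have "u \<noteq> t \<and> \<not> E u t" using False 1 by (auto simp: T_def)
      ultimately show ?thesis by (auto simp: Y_def)
    qed auto
    ultimately show "u \<in> container E V T Y" using u IV by (auto simp: container_def)
  qed
  have "P3_free E (container E V T Y)"
    unfolding P3_free_def
  proof (intro ballI impI, rule ccontr)
    fix a b d assume C: "a \<in> container E V T Y" "b \<in> container E V T Y" "d \<in> container E V T Y"
      and E: "E a b" "E b d" "a \<noteq> d" "\<not> E a d"
    \<comment> \<open>Vertices of \<open>T\<close> are isolated in the container, but each of
      \<open>a\<close>, \<open>b\<close>, \<open>d\<close> has a neighbor there. So the path avoids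
      the closed neighborhood of \<open>X\<close> and would extend the maximal family.\<close>
    have nT: "a \<notin> T" "b \<notin> T" "d \<notin> T"
      using C E sym by (auto simp: container_def)
    have W: "path_verts (a, b, d) \<subseteq> W"
      using C by (auto simp: container_def W_def path_verts_def T_def T1_def)
    have "anticomplete E (path_verts (a, b, d)) Y"
      using C nT by (auto simp: anticomplete_def container_def path_verts_def)
    then have "\<forall>s\<in>set ts. anticomplete E (path_verts (a, b, d)) (path_verts s)"
      unfolding anticomplete_def Y_def X_def by blast
    then have "P3_family E W ((a, b, d) # ts)"
      using ts W E by (auto simp: P3_family_Cons induced_P3_def)
    from tsmax[OF this] show False by simp
  qed
  moreover have "T \<subseteq> V" "Y \<subseteq> V" "T \<noteq> {}" "Y \<noteq> {}"
    using tV T1I IV XW WV by (auto simp: T_def Y_def)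
  moreover have "card T \<le> 2 * r * k + 3 * r + 1" "card Y \<le> 2 * r * k + 3 * r + 1"
    using cT1 cX card_insert_le_m1[of "2 * r * k + 3 * r + 1" T1 t]
      card_insert_le_m1[of "2 * r * k + 3 * r + 1" X t] by (auto simp: T_def Y_def)
  ultimately show ?thesis using that incl I_def by blast
qed

section \<open>List coloring by an auction\<close>

locale auction =
  fixes E :: "'a rel2" and V :: "'a set" and L :: "'a \<Rightarrow> nat set"
  assumes sym: "E u v \<Longrightarrow> E v u" and irrefl: "\<not> E u u" and fin: "finite V"
    and L0: "0 \<notin> L v"
begin

text \<open>Color \<open>0\<close> means uncolored. The label \<open>l c u\<close> is the price of color \<open>c\<close> at \<open>u\<close>.\<close>

definition partial_coloring :: "('a \<Rightarrow> nat) \<Rightarrow> bool" where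
  "partial_coloring \<psi> \<longleftrightarrow>
     (\<forall>u\<in>V. \<psi> u \<noteq> 0 \<longrightarrow> \<psi> u \<in> L u \<and> (\<forall>w\<in>V. E u w \<longrightarrow> \<psi> w \<noteq> \<psi> u))"

text \<open>Constrained only on \<open>V\<close> and on listed colors, so that the cells of a
  machine memory can serve as coloring and labels whatever they contain elsewhere.\<close>

definition bid :: "'a \<Rightarrow> nat \<Rightarrow> ('a \<Rightarrow> nat) \<Rightarrow> (nat \<Rightarrow> 'a \<Rightarrow> nat) \<Rightarrow>
    ('a \<Rightarrow> nat) \<Rightarrow> (nat \<Rightarrow> 'a \<Rightarrow> nat) \<Rightarrow> bool" where
  "bid v c \<psi> l \<psi>' l' \<longleftrightarrow> c \<in> L v \<and> (\<forall>d\<in>L v. l c v \<le> l d v) \<and>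
     (\<forall>u\<in>V. \<psi>' u = (if u = v then c else if E v u \<and> \<psi> u = c then 0 else \<psi> u)) \<and>
     (\<forall>u\<in>V. \<forall>d\<in>L u. l' d u = (if d = c \<and> (u = v \<or> E v u) then l d u + 1 else l d u))"

text \<open>Prices are stored at vertices, so they have to agree on each clique. A clique with
  positive price has an owner. The fourth clause is the approximate complementary slackness of
  auction algorithms: a vertex pays at most one more than its cheapest option.\<close>

definition auction_inv :: "('a \<Rightarrow> nat) \<Rightarrow> (nat \<Rightarrow> 'a \<Rightarrow> nat) \<Rightarrow> bool" where
  "auction_inv \<psi> l \<longleftrightarrow> partial_coloring \<psi> \<and>
     (\<forall>u\<in>V. \<forall>w\<in>V. \<forall>c\<in>L u \<inter> L w. E u w \<longrightarrow> l c u = l c w) \<and>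
     (\<forall>u\<in>V. \<forall>c\<in>L u. l c u > 0 \<longrightarrow> (\<exists>w\<in>V. \<psi> w = c \<and> (w = u \<or> E u w))) \<and>
     (\<forall>u\<in>V. \<psi> u \<noteq> 0 \<longrightarrow> (\<forall>d\<in>L u. l (\<psi> u) u \<le> l d u + 1)) \<and>
     (\<forall>u\<in>V. \<psi> u \<noteq> 0 \<longrightarrow> l (\<psi> u) u \<le> card V)"

text \<open>The total price of the owned cliques. By \<open>auction_inv\<close> all other cliques
  have price 0, so a bid raises the total by exactly one.\<close>

definition potential :: "('a \<Rightarrow> nat) \<Rightarrow> (nat \<Rightarrow> 'a \<Rightarrow> nat) \<Rightarrow> nat" where
  "potential \<psi> l = (\<Sum>u\<in>V. if \<psi> u = 0 then 0 else l (\<psi> u) u)"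

text \<open>A vertex that takes \<open>c\<close> uncolors its neighbors of color \<open>c\<close>.
  This makes a run sound for any lists, those of a wrong guess included.\<close>

lemma partial_coloring_bid:
  assumes "partial_coloring \<psi>" "bid v c \<psi> l \<psi>' l'"
  shows "partial_coloring \<psi>'"
  using assms unfolding partial_coloring_def bid_def by (auto simp: irrefl dest: sym)

context
  assumes free: "P3_free E {v \<in> V. c \<in> L v}"
begin

text \<open>The reflexive form spares case distinctions: equal or adjacent is an equivalence on the
  vertices listing \<open>c\<close>, and its classes are the cliques that carry the prices.\<close>

lemma P3_freeD:
  assumes "u \<in> V" "v \<in> V" "w \<in> V" "c \<in> L u" "c \<in> L v" "c \<in> L w"
    "u = v \<or> E u v" "v = w \<or> E v w"
  shows "u = w \<or> E u w"
  using free assms unfolding P3_free_def by blast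

end

text \<open>
  If all labels at an uncolored \<open>v\<close> were at least \<open>n = |V|\<close>, then sending a vertex \<open>u\<close> to the owner
  of the clique of \<open>u\<close> in color \<open>\<phi> u\<close> would embed \<open>S (j + 1)\<close> into \<open>S j - {v}\<close>, where \<open>S j\<close>
  consists of \<open>v\<close> and the owners of cliques with label at least \<open>j\<close>. So \<open>S 1\<close> would have more
  than \<open>n\<close> elements.
\<close>

lemma label_less_card:
  assumes inv: "auction_inv \<psi> l" and free: "\<And>c. P3_free E {v \<in> V. c \<in> L v}"
    and col: "\<And>u. u \<in> V \<Longrightarrow> \<phi> u \<in> L u" "\<And>u w. u \<in> V \<Longrightarrow> w \<in> V \<Longrightarrow> E u w \<Longrightarrow> \<phi> u \<noteq> \<phi> w"
    and v: "v \<in> V" "\<psi> v = 0"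
  shows "\<exists>d\<in>L v. l d v < card V"
proof (rule ccontr)
  assume "\<not> ?thesis"
  then have big: "l d v \<ge> card V" if "d \<in> L v" for d using that by force
  have n: "card V > 0" using v(1) fin card_gt_0_iff by blast
  define S where "S j = insert v {u\<in>V. \<psi> u \<noteq> 0 \<and> l (\<psi> u) u \<ge> j}" for j
  have finS: "finite (S j)" for j using fin by (auto simp: S_def)
  have owner: "\<exists>w\<in>V. \<psi> w = \<phi> u \<and> (w = u \<or> E u w) \<and> l (\<psi> w) w = l (\<phi> u) u \<and> \<psi> w \<noteq> 0"
    if "u \<in> V" "l (\<phi> u) u > 0" for u
  proof -
    note cu = col(1)[OF that(1)]
    obtain w where w: "w \<in> V" "\<psi> w = \<phi> u" "w = u \<or> E u w"
      using inv \<open>u \<in> V\<close> \<open>l (\<phi> u) u > 0\<close> cu unfolding auction_inv_def by blast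
    have nz: "\<psi> w \<noteq> 0" using w(2) cu L0 by metis
    then have "\<phi> u \<in> L w" using inv w unfolding auction_inv_def partial_coloring_def by metis
    then have "l (\<phi> u) u = l (\<phi> u) w"
      using w(3) inv cu that(1) w(1) unfolding auction_inv_def by blast
    then show ?thesis using w nz by auto
  qed
  have step: "card (S (Suc j)) < card (S j)" if j: "0 < j" "j < card V" for j
  proof -
    \<comment> \<open>By the slackness clause the price of \<open>\<phi> u\<close> at
      \<open>u\<close> is at most one below the price that \<open>u\<close> pays; hence the index
      drops from \<open>Suc j\<close> to \<open>j\<close>.\<close>
    have lab: "u \<in> V \<and> l (\<phi> u) u \<ge> j" if "u \<in> S (Suc j)" for u
    proof (cases "u = v")
      case True
      then show ?thesis using big[of "\<phi> v"] col(1)[OF v(1)] j v(1) by simp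
    next
      case False
      then have u: "u \<in> V" "\<psi> u \<noteq> 0" "l (\<psi> u) u \<ge> Suc j" using that by (auto simp: S_def)
      then have "l (\<psi> u) u \<le> l (\<phi> u) u + 1"
        using inv col(1) unfolding auction_inv_def by blast
      then show ?thesis using u by simp
    qed
    define f where "f u = (SOME w. w \<in> V \<and> \<psi> w = \<phi> u \<and> (w = u \<or> E u w) \<and>
      l (\<psi> w) w = l (\<phi> u) u \<and> \<psi> w \<noteq> 0)" for u
    have f: "f u \<in> V \<and> \<psi> (f u) = \<phi> u \<and> (f u = u \<or> E u (f u)) \<and>
      l (\<psi> (f u)) (f u) = l (\<phi> u) u \<and> \<psi> (f u) \<noteq> 0" if "u \<in> S (Suc j)" for u
      unfolding f_def by (rule someI_ex) (use owner[of u] lab[OF that] j in auto)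
    have "f ` S (Suc j) \<subseteq> S j - {v}"
    proof
      fix w assume "w \<in> f ` S (Suc j)"
      then obtain u where u: "u \<in> S (Suc j)" "w = f u" by blast
      show "w \<in> S j - {v}" using f[OF u(1)] lab[OF u(1)] v(2) unfolding u(2) S_def by auto
    qed
    \<comment> \<open>Two vertices with the same owner lie in one clique and have the same color
      under \<open>\<phi>\<close>. They are equal or adjacent, and \<open>\<phi>\<close> is
      proper.\<close>
    moreover have "inj_on f (S (Suc j))"
    proof (rule inj_onI, rule ccontr)
      fix u w assume uw: "u \<in> S (Suc j)" "w \<in> S (Suc j)" "f u = f w" "u \<noteq> w"
      define x where "x = f u"
      have x: "x \<in> V" "\<psi> x = \<phi> u" "\<psi> x = \<phi> w" "x = u \<or> E u x" "x = w \<or> E w x" "\<psi> x \<noteq> 0"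
        using f[OF uw(1)] f[OF uw(2)] uw(3) by (auto simp: x_def)
      have V: "u \<in> V" "w \<in> V" using lab uw by auto
      have "\<psi> x \<in> L x" using inv x unfolding auction_inv_def partial_coloring_def by metis
      moreover have "\<psi> x \<in> L u" "\<psi> x \<in> L w" using col(1) V x(2,3) by metis+
      ultimately have "u = w \<or> E u w"
        using P3_freeD[OF free, of u x w "\<psi> x"] V x sym by blast
      then show False using col(2)[OF V] uw(4) x by auto
    qed
    ultimately have "card (S (Suc j)) \<le> card (S j - {v})"
      by (metis card_inj_on_le finS finite_Diff)
    also have "\<dots> < card (S j)" by (rule card_Diff1_less[OF finS]) (simp add: S_def)
    finally show ?thesis .
  qed
  \<comment> \<open>The clique of \<open>v\<close> in color \<open>\<phi> v\<close> has positive
    price and so an owner, which is not the uncolored \<open>v\<close>. So \<open>S (card V)\<close>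
    has two elements, and each of the \<open>card V - 1\<close> steps down to \<open>S 1\<close>
    adds one.\<close>
  obtain w where w: "w \<in> V" "l (\<psi> w) w \<ge> card V" "\<psi> w \<noteq> 0"
    using owner[OF v(1)] big[OF col(1)[OF v(1)]] n by force
  then have "{v, w} \<subseteq> S (card V)" by (auto simp: S_def)
  moreover have "v \<noteq> w" using w v by auto
  ultimately have top: "card (S (card V)) \<ge> 2"
    using card_mono[OF finS, of "{v, w}" "card V"] by simp
  have "card (S (card V - i)) \<ge> 2 + i" if "i < card V" for i
    using that
  proof (induction i)
    case (Suc i)
    have "card V - i = Suc (card V - Suc i)" using Suc.prems by simp
    then show ?case using Suc.IH Suc.prems step[of "card V - Suc i"] by simp
  qed (use top in simp)
  from this[of "card V - 1"] n have "card (S 1) \<ge> card V + 1" by simp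
  moreover have "card (S 1) \<le> card V"
    by (rule card_mono[OF fin]) (use v in \<open>auto simp: S_def\<close>)
  ultimately show False by simp
qed

text \<open>The new owner \<open>v\<close> replaces the evicted one, if any, and pays one more than
  the clique cost before; this gives the growth of the potential. The coloring \<open>\<phi>\<close>
  enters through \<open>label_less_card\<close>, which keeps the new price at most
  \<open>card V\<close>.\<close>

lemma auction_inv_bid:
  assumes inv: "auction_inv \<psi> l" and free: "\<And>c. P3_free E {v \<in> V. c \<in> L v}"
    and col: "\<And>u. u \<in> V \<Longrightarrow> \<phi> u \<in> L u" "\<And>u w. u \<in> V \<Longrightarrow> w \<in> V \<Longrightarrow> E u w \<Longrightarrow> \<phi> u \<noteq> \<phi> w"
    and v: "v \<in> V" "\<psi> v = 0" and bid: "bid v c \<psi> l \<psi>' l'"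
  shows "auction_inv \<psi>' l'" and "potential \<psi>' l' = potential \<psi> l + 1"
proof -
  have pc: "partial_coloring \<psi>" using inv by (simp add: auction_inv_def)
  have cL: "c \<in> L v" and cmin: "\<And>d. d \<in> L v \<Longrightarrow> l c v \<le> l d v"
    and \<psi>': "\<And>u. u \<in> V \<Longrightarrow> \<psi>' u = (if u = v then c else if E v u \<and> \<psi> u = c then 0 else \<psi> u)"
    and l': "\<And>u d. u \<in> V \<Longrightarrow> d \<in> L u \<Longrightarrow>
      l' d u = (if d = c \<and> (u = v \<or> E v u) then l d u + 1 else l d u)"
    using bid by (auto simp: bid_def)
  have c0: "c \<noteq> 0" using cL L0 by metis
  have mem: "\<psi> u \<in> L u" if "u \<in> V" "\<psi> u \<noteq> 0" for u
    using pc that by (auto simp: partial_coloring_def)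
  have cl: "l d u = l d w" if "u \<in> V" "w \<in> V" "d \<in> L u" "d \<in> L w" "E u w" for u w d
    using inv that unfolding auction_inv_def by blast
  \<comment> \<open>A clique of color \<open>c\<close> lies inside or outside the closed
    neighborhood of \<open>v\<close>, so raising the label there keeps prices constant on
    cliques.\<close>
  have ball: "(u = v \<or> E v u) \<longleftrightarrow> (w = v \<or> E v w)"
    if "u \<in> V" "w \<in> V" "c \<in> L u" "c \<in> L w" "E u w" for u w
    using P3_freeD[OF free, of v u w c] P3_freeD[OF free, of v w u c] that v cL sym by blast
  \<comment> \<open>The only other vertices whose price would rise are neighbors of \<open>v\<close>
    with color \<open>c\<close>, and these become uncolored.\<close>
  have kept: "l' (\<psi>' u) u = l (\<psi> u) u" if "u \<in> V" "u \<noteq> v" "\<psi>' u \<noteq> 0" for u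
    using that \<psi>'[OF that(1)] l'[OF that(1) mem[OF that(1)]] by (auto split: if_splits)
  have new: "l' (\<psi>' v) v = l c v + 1" using \<psi>'[OF v(1)] l'[OF v(1) cL] by simp
  have mono: "l d u \<le> l' d u" if "u \<in> V" "d \<in> L u" for d u using l'[OF that] by auto
  show "auction_inv \<psi>' l'"
    unfolding auction_inv_def
  proof (intro conjI ballI impI)
    show "partial_coloring \<psi>'" by (rule partial_coloring_bid[OF pc bid])
  next
    fix u w d assume "u \<in> V" "w \<in> V" "d \<in> L u \<inter> L w" "E u w"
    then show "l' d u = l' d w" using l' cl[of u w d] ball[of u w] by auto
  next
    fix u d assume u: "u \<in> V" "d \<in> L u" "0 < l' d u"
    show "\<exists>w\<in>V. \<psi>' w = d \<and> (w = u \<or> E u w)"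
    proof (cases "d = c \<and> (u = v \<or> E v u)")
      case True
      then show ?thesis using \<psi>'[OF v(1)] v(1) sym by (intro bexI[of _ v]) auto
    next
      case False
      then have "l d u > 0" using l'[OF u(1,2)] u(3) by auto
      then obtain w where w: "w \<in> V" "\<psi> w = d" "w = u \<or> E u w"
        using inv u unfolding auction_inv_def by blast
      have d0: "d \<noteq> 0" using u(2) L0 by metis
      \<comment> \<open>The owner of a clique other than that of \<open>v\<close> is not evicted:
        otherwise \<open>u\<close>, being in its clique, would be in the clique of
        \<open>v\<close>.\<close>
      have "\<not> (E v w \<and> d = c)"
        using False P3_freeD[OF free, of v w u c] v(1) w u cL mem[OF w(1)] d0 sym by blast
      then have "\<psi>' w = d" using \<psi>'[OF w(1)] w v(2) d0 by auto
      then show ?thesis using w by auto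
    qed
  next
    fix u d assume u: "u \<in> V" "\<psi>' u \<noteq> 0" "d \<in> L u"
    show "l' (\<psi>' u) u \<le> l' d u + 1"
    proof (cases "u = v")
      case True
      then show ?thesis using new cmin[of d] mono[of v d] u by simp
    next
      case False
      have "\<psi> u \<noteq> 0" using \<psi>'[OF u(1)] u(2) False by (auto split: if_splits)
      then have "l (\<psi> u) u \<le> l d u + 1" using inv u unfolding auction_inv_def by blast
      then show ?thesis using kept[OF u(1) False u(2)] mono[OF u(1,3)] by simp
    qed
  next
    fix u assume u: "u \<in> V" "\<psi>' u \<noteq> 0"
    show "l' (\<psi>' u) u \<le> card V"
    proof (cases "u = v")
      case True
      obtain d where "d \<in> L v" "l d v < card V"
        using label_less_card[OF inv free col v] by blast
      then show ?thesis using True new cmin[of d] by simp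
    next
      case False
      have "\<psi> u \<noteq> 0" using \<psi>'[OF u(1)] u(2) False by (auto split: if_splits)
      then show ?thesis using inv u kept[OF u(1) False u(2)] unfolding auction_inv_def by auto
    qed
  qed
  define g where "g u = (if \<psi> u = 0 then 0 else l (\<psi> u) u)" for u
  define h where "h u = (if \<psi>' u = 0 then 0 else l' (\<psi>' u) u)" for u
  have gv: "g v = 0" and hv: "h v = l c v + 1" using v(2) new \<psi>'[OF v(1)] c0 by (auto simp: g_def h_def)
  \<comment> \<open>The evicted vertices. There is at most one, since two would be adjacent with
    equal color. If there is none, the clique had no owner and so price 0.\<close>
  define D where "D = {u \<in> V. E v u \<and> \<psi> u = c}"
  have D: "u \<in> V \<Longrightarrow> u \<noteq> v \<Longrightarrow> u \<notin> D \<Longrightarrow> h u = g u" for u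
    using \<psi>'[of u] kept[of u] by (auto simp: g_def h_def D_def)
  have Dh: "h u = 0" "g u = l c v" "u \<noteq> v" "u \<in> V" if "u \<in> D" for u
  proof -
    have u: "u \<in> V" "E v u" "\<psi> u = c" using that by (auto simp: D_def)
    then show "u \<noteq> v" "u \<in> V" using irrefl by auto
    then show "h u = 0" using u \<psi>'[of u] by (simp add: h_def)
    show "g u = l c v" using cl[of v u c] u v(1) cL mem[of u] c0 by (simp add: g_def)
  qed
  have eq: "(\<Sum>u\<in>V. h u) = (\<Sum>u\<in>V. g u) + 1"
  proof (cases "D = {}")
    case True
    have "(\<Sum>u\<in>V - {v}. h u) = (\<Sum>u\<in>V - {v}. g u)" using D True by (intro sum.cong) auto
    moreover have "l c v = 0"
    proof (rule ccontr)
      assume "l c v \<noteq> 0"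
      then obtain w where "w \<in> V" "\<psi> w = c" "w = v \<or> E v w"
        using inv v(1) cL unfolding auction_inv_def by blast
      then show False using True v(2) c0 by (auto simp: D_def)
    qed
    ultimately show ?thesis using sum.remove[OF fin v(1), of h] sum.remove[OF fin v(1), of g] gv hv by simp
  next
    case False
    then obtain w where w: "w \<in> D" by blast
    have "u = w" if "u \<in> D" for u
    proof (rule ccontr)
      assume "u \<noteq> w"
      have uw: "u \<in> V" "w \<in> V" "E v u" "E v w" "\<psi> u = c" "\<psi> w = c" using that w by (auto simp: D_def)
      then have "E u w"
        using \<open>u \<noteq> w\<close> P3_freeD[OF free, of u v w c] v(1) cL mem[of u] mem[of w] c0 sym by auto
      then show False using pc uw c0 by (auto simp: partial_coloring_def)
    qed
    then have "(\<Sum>u\<in>V - {v} - {w}. h u) = (\<Sum>u\<in>V - {v} - {w}. g u)"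
      using D by (intro sum.cong) auto
    moreover have "w \<in> V - {v}" "finite (V - {v})" using Dh(3,4)[OF w] fin by auto
    ultimately show ?thesis using sum.remove[OF fin v(1), of h] sum.remove[OF fin v(1), of g]
        sum.remove[of "V - {v}" w h] sum.remove[of "V - {v}" w g] gv hv Dh(1,2)[OF w] by simp
  qed
  then show "potential \<psi>' l' = potential \<psi> l + 1" by (simp add: potential_def g_def h_def)
qed

text \<open>The uncolored \<open>v\<close> contributes nothing and each other vertex at most
  \<open>card V\<close>. As bids raise the potential by one, this bounds their number.\<close>

lemma potential_less:
  assumes inv: "auction_inv \<psi> l" and v: "v \<in> V" "\<psi> v = 0"
  shows "potential \<psi> l < card V * card V"
proof -
  have "potential \<psi> l = (\<Sum>u\<in>V - {v}. if \<psi> u = 0 then 0 else l (\<psi> u) u)"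
    using sum.remove[OF fin v(1), of "\<lambda>u. if \<psi> u = 0 then 0 else l (\<psi> u) u"] v(2)
    by (simp add: potential_def)
  also have "\<dots> \<le> card (V - {v}) * card V"
    using inv by (intro order_trans[OF sum_bounded_above[of _ _ "card V"]]) (auto simp: auction_inv_def)
  also have "\<dots> < card V * card V"
    using card_Diff1_less[OF fin v(1)] by simp
  finally show ?thesis .
qed

end

section \<open>A language of bounded loops\<close>

text \<open>
  Register 1 holds the bound \<open>n\<close> of all loops, so every program runs in time polynomial in \<open>n\<close>.
  Compilation uses the registers from \<open>D\<close> on as temporaries.
\<close>

datatype expr = Var nat | Const nat | Add expr expr | Sub expr expr | Mem expr

fun eval :: "expr \<Rightarrow> state \<Rightarrow> nat" where
  "eval (Var x) s = fst s x"
| "eval (Const a) s = a"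
| "eval (Add e f) s = eval e s + eval f s"
| "eval (Sub e f) s = eval e s - eval f s"
| "eval (Mem e) s = snd s (eval e s)"

fun expr_wf :: "nat \<Rightarrow> expr \<Rightarrow> bool" where
  "expr_wf D (Var x) \<longleftrightarrow> x < D"
| "expr_wf D (Const a) \<longleftrightarrow> True"
| "expr_wf D (Add e f) \<longleftrightarrow> expr_wf D e \<and> expr_wf D f"
| "expr_wf D (Sub e f) \<longleftrightarrow> expr_wf D e \<and> expr_wf D f"
| "expr_wf D (Mem e) \<longleftrightarrow> expr_wf D e"

text \<open>Register \<open>d\<close> receives the value, and the registers above it serve as a
  stack for second operands. Copying is addition to a cleared register, as there is no move
  instruction.\<close>

fun comp_expr :: "expr \<Rightarrow> nat \<Rightarrow> ram" where
  "comp_expr (Var x) d = Seq (SetConst d 0) (Plus d x d)"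
| "comp_expr (Const a) d = SetConst d a"
| "comp_expr (Add e f) d = Seq (comp_expr e d) (Seq (comp_expr f (Suc d)) (Plus d d (Suc d)))"
| "comp_expr (Sub e f) d = Seq (comp_expr e d) (Seq (comp_expr f (Suc d)) (Minus d d (Suc d)))"
| "comp_expr (Mem e) d = Seq (comp_expr e d) (Read d d)"

fun expr_time :: "expr \<Rightarrow> nat" where
  "expr_time (Var x) = 2"
| "expr_time (Const a) = 1"
| "expr_time (Add e f) = expr_time e + expr_time f + 1"
| "expr_time (Sub e f) = expr_time e + expr_time f + 1"
| "expr_time (Mem e) = expr_time e + 1"

lemma eval_cong: "expr_wf D e \<Longrightarrow> (\<And>x. x < D \<Longrightarrow> R x = R' x) \<Longrightarrow> eval e (R, M) = eval e (R', M)"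
  by (induction e) auto

lemma comp_expr:
  "expr_wf d e \<Longrightarrow> \<exists>R'. exec (comp_expr e d) (R, M) (expr_time e) (R', M) \<and>
     R' d = eval e (R, M) \<and> (\<forall>x<d. R' x = R x)"
proof (induction e arbitrary: d R)
  case (Var x)
  have "exec (comp_expr (Var x) d) (R, M) (1 + 1) (R(d := 0, d := (R(d := 0)) x + (R(d := 0)) d), M)"
    unfolding comp_expr.simps by (rule exec.Seq[OF exec.SetConst exec.Plus])
  then have "exec (comp_expr (Var x) d) (R, M) (expr_time (Var x)) (R(d := R x), M)"
    using Var by (simp add: numeral_2_eq_2)
  moreover have "(R(d := R x)) d = eval (Var x) (R, M)" "\<forall>y<d. (R(d := R x)) y = R y" by auto
  ultimately show ?case by blast
next
  case (Const a)
  have "exec (comp_expr (Const a) d) (R, M) 1 (R(d := a), M)"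
    unfolding comp_expr.simps by (intro exec.intros)
  moreover have "(R(d := a)) d = eval (Const a) (R, M)" "\<forall>y<d. (R(d := a)) y = R y" by auto
  ultimately show ?case unfolding expr_time.simps by blast
next
  case (Add e f)
  have wf: "expr_wf d e" "expr_wf (Suc d) f" "expr_wf d f"
  proof -
    have "expr_wf d f \<Longrightarrow> expr_wf (Suc d) f" for d by (induction f) auto
    then show "expr_wf d e" "expr_wf (Suc d) f" "expr_wf d f" using Add.prems by auto
  qed
  obtain R1 where R1: "exec (comp_expr e d) (R, M) (expr_time e) (R1, M)"
    "R1 d = eval e (R, M)" "\<forall>x<d. R1 x = R x" using Add.IH(1)[OF wf(1)] by blast
  obtain R2 where R2: "exec (comp_expr f (Suc d)) (R1, M) (expr_time f) (R2, M)"
    "R2 (Suc d) = eval f (R1, M)" "\<forall>x<Suc d. R2 x = R1 x" using Add.IH(2)[OF wf(2)] by blast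
  have "exec (comp_expr (Add e f) d) (R, M) (expr_time e + (expr_time f + 1)) (R2(d := R2 d + R2 (Suc d)), M)"
    unfolding comp_expr.simps by (rule exec.Seq[OF R1(1) exec.Seq[OF R2(1) exec.Plus]])
  then show ?case using R1 R2 eval_cong[OF wf(3), of R1 R]
    by (intro exI[of _ "R2(d := R2 d + R2 (Suc d))"]) (simp add: add.assoc del: fun_upd_apply; simp)
next
  case (Sub e f)
  have wf: "expr_wf d e" "expr_wf (Suc d) f" "expr_wf d f"
  proof -
    have "expr_wf d f \<Longrightarrow> expr_wf (Suc d) f" for d by (induction f) auto
    then show "expr_wf d e" "expr_wf (Suc d) f" "expr_wf d f" using Sub.prems by auto
  qed
  obtain R1 where R1: "exec (comp_expr e d) (R, M) (expr_time e) (R1, M)"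
    "R1 d = eval e (R, M)" "\<forall>x<d. R1 x = R x" using Sub.IH(1)[OF wf(1)] by blast
  obtain R2 where R2: "exec (comp_expr f (Suc d)) (R1, M) (expr_time f) (R2, M)"
    "R2 (Suc d) = eval f (R1, M)" "\<forall>x<Suc d. R2 x = R1 x" using Sub.IH(2)[OF wf(2)] by blast
  have "exec (comp_expr (Sub e f) d) (R, M) (expr_time e + (expr_time f + 1)) (R2(d := R2 d - R2 (Suc d)), M)"
    unfolding comp_expr.simps by (rule exec.Seq[OF R1(1) exec.Seq[OF R2(1) exec.Minus]])
  then show ?case using R1 R2 eval_cong[OF wf(3), of R1 R]
    by (intro exI[of _ "R2(d := R2 d - R2 (Suc d))"]) (simp add: add.assoc del: fun_upd_apply; simp)
next
  case (Mem e)
  then obtain R1 where R1: "exec (comp_expr e d) (R, M) (expr_time e) (R1, M)"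
    "R1 d = eval e (R, M)" "\<forall>x<d. R1 x = R x" by fastforce
  have "exec (comp_expr (Mem e) d) (R, M) (expr_time e + 1) (R1(d := M (R1 d)), M)"
    unfolding comp_expr.simps by (rule exec.Seq[OF R1(1) exec.Read])
  then show ?case using R1 by (intro exI[of _ "R1(d := M (R1 d))"]) (simp del: fun_upd_apply; simp)
qed

lemma expr_wf_mono: "expr_wf d e \<Longrightarrow> d \<le> d' \<Longrightarrow> expr_wf d' e"
  by (induction e) auto

section \<open>Commands with bounded loops and their compilation\<close>

datatype cmd = Skip | Assign nat expr | Store expr expr | Then cmd cmd (infixr \<open>;;\<close> 60)
  | If expr cmd cmd | For nat cmd

text \<open>Total, since a loop runs through \<open>0..<n\<close> for the value \<open>n\<close> of
  register 1 on entry. The loop variable ends with \<open>n\<close>, as it does after the compiled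
  loop.\<close>

fun sem :: "cmd \<Rightarrow> state \<Rightarrow> state" where
  "sem Skip s = s"
| "sem (Assign x e) s = ((fst s)(x := eval e s), snd s)"
| "sem (Store e f) s = (fst s, (snd s)(eval e s := eval f s))"
| "sem (c ;; d) s = sem d (sem c s)"
| "sem (If e c d) s = (if eval e s \<noteq> 0 then sem c s else sem d s)"
| "sem (For x c) s =
     (let s' = fold (\<lambda>i s. sem c ((fst s)(x := i), snd s)) [0..<fst s 1] s
      in ((fst s')(x := fst s 1), snd s'))"

fun writes :: "cmd \<Rightarrow> nat set" where
  "writes Skip = {}"
| "writes (Assign x e) = {x}"
| "writes (Store e f) = {}"
| "writes (c ;; d) = writes c \<union> writes d"
| "writes (If e c d) = writes c \<union> writes d"
| "writes (For x c) = insert x (writes c)"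

text \<open>Neither register 1 nor the variable of an enclosing loop is ever assigned, so the number
  of passes is fixed on entry.\<close>

fun cmd_wf :: "nat \<Rightarrow> cmd \<Rightarrow> bool" where
  "cmd_wf D Skip \<longleftrightarrow> True"
| "cmd_wf D (Assign x e) \<longleftrightarrow> x < D \<and> x \<noteq> 1 \<and> expr_wf D e"
| "cmd_wf D (Store e f) \<longleftrightarrow> expr_wf D e \<and> expr_wf D f"
| "cmd_wf D (c ;; d) \<longleftrightarrow> cmd_wf D c \<and> cmd_wf D d"
| "cmd_wf D (If e c d) \<longleftrightarrow> expr_wf D e \<and> cmd_wf D c \<and> cmd_wf D d"
| "cmd_wf D (For x c) \<longleftrightarrow> x < D \<and> x \<noteq> 1 \<and> x \<notin> writes c \<and> cmd_wf D c"

text \<open>The loop test \<open>n - x\<close> is kept in register \<open>D\<close> and recomputed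
  after each pass, because the body overwrites the temporaries.\<close>

fun comp :: "nat \<Rightarrow> cmd \<Rightarrow> ram" where
  "comp D Skip = SetConst D 0"
| "comp D (Assign x e) = Seq (comp_expr e D) (Seq (SetConst (Suc D) 0) (Plus x D (Suc D)))"
| "comp D (Store e f) = Seq (comp_expr e D) (Seq (comp_expr f (Suc D)) (Write D (Suc D)))"
| "comp D (c ;; d) = Seq (comp D c) (comp D d)"
| "comp D (If e c d) = Seq (comp_expr e D) (IfNZ D (comp D c) (comp D d))"
| "comp D (For x c) = Seq (SetConst x 0) (Seq (Minus D 1 x)
     (WhileNZ D (Seq (comp D c) (Seq (SetConst D 1) (Seq (Plus x x D) (Minus D 1 x))))))"

text \<open>A polynomial in the content of register 1. The times of both branches are added, which
  stays polynomial. A pass costs 4 steps besides the body; the other 3 are two initial instructions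
  and the last test.\<close>

fun cmd_time :: "cmd \<Rightarrow> nat poly" where
  "cmd_time Skip = [:1:]"
| "cmd_time (Assign x e) = [:expr_time e + 2:]"
| "cmd_time (Store e f) = [:expr_time e + expr_time f + 1:]"
| "cmd_time (c ;; d) = cmd_time c + cmd_time d"
| "cmd_time (If e c d) = [:expr_time e + 1:] + cmd_time c + cmd_time d"
| "cmd_time (For x c) = [:0, 1:] * (cmd_time c + [:4:]) + [:3:]"

lemma fold_invariant_nat:
  assumes "P 0 s" "\<And>i s. i < n \<Longrightarrow> P i s \<Longrightarrow> P (Suc i) (f i s)"
  shows "P n (fold f [0..<n] s)"
proof -
  have "m \<le> n \<Longrightarrow> P m (fold f [0..<m] s)" for m
    using assms by (induction m) auto
  then show ?thesis by simp
qed

lemma sem_frame: "x \<notin> writes c \<Longrightarrow> fst (sem c s) x = fst s x"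
proof (induction c arbitrary: s)
  case (For y c)
  have "fst (fold (\<lambda>i s. sem c ((fst s)(y := i), snd s)) [0..<fst s 1] s) x = fst s x"
    by (rule fold_invariant_nat[where P = "\<lambda>_ s'. fst s' x = fst s x"]) (use For in auto)
  then show ?case using For.prems by (auto simp: Let_def)
qed auto

lemma wf_bound: "cmd_wf D c \<Longrightarrow> 1 \<notin> writes c"
  by (induction c) auto

definition agree :: "nat \<Rightarrow> state \<Rightarrow> state \<Rightarrow> bool" where
  "agree D s s' \<longleftrightarrow> snd s = snd s' \<and> (\<forall>x<D. fst s x = fst s' x)"

lemma eval_agree: "expr_wf D e \<Longrightarrow> agree D s s' \<Longrightarrow> eval e s = eval e s'"
  by (induction e) (auto simp: agree_def)

lemma comp_expr_agree:
  assumes "expr_wf D e" "agree D s s'" "D \<le> d"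
  shows "\<exists>s''. exec (comp_expr e d) s' (expr_time e) s'' \<and> agree D s s'' \<and>
    fst s'' d = eval e s \<and> (\<forall>x<d. fst s'' x = fst s' x)"
proof -
  obtain R M where s': "s' = (R, M)" by fastforce
  obtain R' where "exec (comp_expr e d) (R, M) (expr_time e) (R', M)" "R' d = eval e (R, M)"
    "\<forall>x<d. R' x = R x" using comp_expr[OF expr_wf_mono[OF assms(1,3)]] by blast
  then show ?thesis using assms s' eval_agree[OF assms(1,2)]
    by (intro exI[of _ "(R', M)"]) (auto simp: agree_def)
qed

text \<open>Simulation by induction on the command. Since \<open>agree\<close> ignores the registers
  from \<open>D\<close> on, leftovers of earlier temporaries do no harm.\<close>

lemma comp_correct:
  assumes "cmd_wf D c" "D > 1" "agree D s s'"
  shows "\<exists>t s''. exec (comp D c) s' t s'' \<and> t \<le> poly (cmd_time c) (fst s 1) \<and> agree D (sem c s) s''"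
  using assms
proof (induction c arbitrary: s s')
  case Skip
  have "exec (comp D Skip) s' 1 ((fst s')(D := 0), snd s')"
    using exec.SetConst[of D 0 "fst s'" "snd s'"] by simp
  then show ?case using Skip by (intro exI conjI) (auto simp: agree_def)
next
  case (Assign x e)
  obtain s1 where s1: "exec (comp_expr e D) s' (expr_time e) s1" "agree D s s1" "fst s1 D = eval e s"
    using comp_expr_agree[of D e s s', OF _ _ order_refl] Assign.prems unfolding cmd_wf.simps by blast
  have "exec (comp D (Assign x e)) s' (expr_time e + (1 + 1))
      ((fst s1)(Suc D := 0, x := ((fst s1)(Suc D := 0)) D + ((fst s1)(Suc D := 0)) (Suc D)), snd s1)"
    unfolding comp.simps
    by (rule exec.Seq[OF s1(1) exec.Seq[OF _ exec.Plus]])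
      (use exec.SetConst[of "Suc D" 0 "fst s1" "snd s1"] in simp)
  then show ?case using s1 Assign.prems by (intro exI conjI) (auto simp: agree_def)
next
  case (Store e f)
  obtain s1 where s1: "exec (comp_expr e D) s' (expr_time e) s1" "agree D s s1" "fst s1 D = eval e s"
    using comp_expr_agree[of D e s s', OF _ _ order_refl] Store.prems unfolding cmd_wf.simps by blast
  obtain s2 where s2: "exec (comp_expr f (Suc D)) s1 (expr_time f) s2" "agree D s s2"
    "fst s2 (Suc D) = eval f s" "fst s2 D = fst s1 D"
    using comp_expr_agree[of D f s s1 "Suc D"] Store.prems s1(2) unfolding cmd_wf.simps by (metis le_add2 lessI plus_1_eq_Suc)
  have "exec (comp D (Store e f)) s' (expr_time e + (expr_time f + 1))
      (fst s2, (snd s2)(fst s2 D := fst s2 (Suc D)))"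
    unfolding comp.simps using s1(1) s2(1)
    by (intro exec.Seq) (use exec.Write[of D "Suc D" "fst s2" "snd s2"] in auto)
  then show ?case using s1 s2 by (intro exI conjI) (auto simp: agree_def)
next
  case (Then c d)
  obtain t1 s1 where s1: "exec (comp D c) s' t1 s1" "t1 \<le> poly (cmd_time c) (fst s 1)" "agree D (sem c s) s1"
    using Then.IH(1)[of s s'] Then.prems by auto
  obtain t2 s2 where s2: "exec (comp D d) s1 t2 s2" "t2 \<le> poly (cmd_time d) (fst (sem c s) 1)"
    "agree D (sem d (sem c s)) s2"
    using Then.IH(2)[of "sem c s" s1] Then.prems s1 by auto
  have "fst (sem c s) 1 = fst s 1" using sem_frame[OF wf_bound, of D c s] Then.prems by simp
  then show ?case using exec.Seq[OF s1(1) s2(1)] s1 s2 by (intro exI conjI) auto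
next
  case (If e c d)
  obtain s1 where s1: "exec (comp_expr e D) s' (expr_time e) s1" "agree D s s1" "fst s1 D = eval e s"
    using comp_expr_agree[of D e s s', OF _ _ order_refl] If.prems unfolding cmd_wf.simps by blast
  show ?case
  proof (cases "eval e s = 0")
    case True
    obtain t2 s2 where s2: "exec (comp D d) s1 t2 s2" "t2 \<le> poly (cmd_time d) (fst s 1)"
      "agree D (sem d s) s2" using If.IH(2)[of s s1] If.prems s1 by auto
    have "exec (comp D (If e c d)) s' (expr_time e + (1 + t2)) s2"
      unfolding comp.simps using s1 s2 True by (intro exec.Seq exec.IfFalse) auto
    then show ?thesis using True s2 by (intro exI conjI) auto
  next
    case False
    obtain t2 s2 where s2: "exec (comp D c) s1 t2 s2" "t2 \<le> poly (cmd_time c) (fst s 1)"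
      "agree D (sem c s) s2" using If.IH(1)[of s s1] If.prems s1 by auto
    have "exec (comp D (If e c d)) s' (expr_time e + (1 + t2)) s2"
      unfolding comp.simps using s1 s2 False by (intro exec.Seq exec.IfTrue) auto
    then show ?thesis using False s2 by (intro exI conjI) auto
  qed
next
  case (For x c)
  define n where "n = fst s 1"
  define T where "T = poly (cmd_time c) n + 4"
  define f where "f i s = sem c ((fst s)(x := i), snd s)" for i s
  let ?body = "Seq (comp D c) (Seq (SetConst D 1) (Seq (Plus x x D) (Minus D 1 x)))"
  have wf: "x < D" "x \<noteq> 1" "x \<notin> writes c" "cmd_wf D c" "1 \<notin> writes c"
    using For.prems(1) wf_bound by auto
  \<comment> \<open>Generalized to a loop entered at \<open>i\<close> with \<open>j\<close> passes
    to go, so that the induction can run over \<open>j\<close>.\<close>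
  have loop: "\<exists>t s2. exec (WhileNZ D ?body) s1 t s2 \<and> t \<le> j * T + 1 \<and>
      agree D ((fst (fold f [i..<n] s0))(x := n), snd (fold f [i..<n] s0)) s2"
    if "i + j = n" "agree D ((fst s0)(x := i), snd s0) s1" "fst s1 D = n - i" "fst s0 1 = n" for i j s0 s1
    using that
  proof (induction j arbitrary: i s0 s1)
    case 0
    then show ?case using exec.WhileFalse[of s1 D ?body] by (intro exI conjI) auto
  next
    case (Suc j)
    let ?s = "((fst s0)(x := i), snd s0)"
    have n1: "fst ?s 1 = n" using Suc.prems wf by auto
    obtain t1 s2 where s2: "exec (comp D c) s1 t1 s2" "t1 \<le> poly (cmd_time c) n" "agree D (f i s0) s2"
      using For.IH[OF wf(4) For.prems(2) Suc.prems(2)] unfolding n1 f_def by blast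
    let ?R2 = "fst s2"
    let ?R3 = "?R2(D := 1)"
    let ?R4 = "?R3(x := ?R3 x + ?R3 D)"
    let ?R5 = "?R4(D := ?R4 1 - ?R4 x)"
    have ex: "exec ?body s1 (t1 + (1 + (1 + 1))) (?R5, snd s2)"
      by (intro exec.Seq[OF s2(1)] exec.Seq[OF _ exec.Seq[OF exec.Plus exec.Minus]])
        (use exec.SetConst[of D 1 "fst s2" "snd s2"] in auto)
    have fx: "fst (f i s0) x = i" "fst (f i s0) 1 = n"
      using sem_frame[OF wf(3)] sem_frame[OF wf(5)] n1 by (auto simp: f_def)
    then have R2: "?R2 x = i" "?R2 1 = n" using s2(3) wf(1) For.prems(2) by (auto simp: agree_def)
    have "agree D ((fst (f i s0))(x := Suc i), snd (f i s0)) (?R5, snd s2)"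
      using s2(3) R2 wf(1) by (auto simp: agree_def)
    moreover have "fst (?R5, snd s2) D = n - Suc i" using R2 wf For.prems(2) by auto
    ultimately obtain t3 s3 where s3: "exec (WhileNZ D ?body) (?R5, snd s2) t3 s3" "t3 \<le> j * T + 1"
      "agree D ((fst (fold f [Suc i..<n] (f i s0)))(x := n), snd (fold f [Suc i..<n] (f i s0))) s3"
      using Suc.IH[of "Suc i" "f i s0" "(?R5, snd s2)"] Suc.prems(1) fx(2) by (metis add_Suc_shift)
    have "exec (WhileNZ D ?body) s1 (1 + (t1 + (1 + (1 + 1))) + t3) s3"
      using Suc.prems by (intro exec.WhileTrue[OF _ ex s3(1)]) auto
    moreover have "1 + (t1 + (1 + (1 + 1))) + t3 \<le> Suc j * T + 1"
      using s2(2) s3(2) by (simp add: T_def)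
    moreover have "fold f [i..<n] s0 = fold f [Suc i..<n] (f i s0)"
      using Suc.prems by (simp add: upt_conv_Cons)
    ultimately show ?case using s3(3) by metis
  qed
  let ?R = "(fst s')(x := 0)"
  let ?R' = "?R(D := ?R 1 - ?R x)"
  have ag: "agree D ((fst s)(x := 0), snd s) (?R', snd s')" and D: "fst (?R', snd s') D = n - 0"
    and n: "0 + n = n" "fst s 1 = n"
    using For.prems wf by (auto simp: agree_def n_def)
  obtain t s2 where s2: "exec (WhileNZ D ?body) (?R', snd s') t s2" "t \<le> n * T + 1"
    "agree D ((fst (fold f [0..<n] s))(x := n), snd (fold f [0..<n] s)) s2"
    using loop[OF n(1) ag D n(2)] by blast
  have "exec (comp D (For x c)) s' (1 + (1 + t)) s2"
    unfolding comp.simps using s2(1)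
    by (intro exec.Seq[OF _ exec.Seq[OF exec.Minus]]) (use exec.SetConst[of x 0 "fst s'" "snd s'"] in auto)
  moreover have "1 + (1 + t) \<le> poly (cmd_time (For x c)) (fst s 1)"
    using s2(2) by (simp add: T_def n_def algebra_simps)
  moreover have "agree D (sem (For x c) s) s2"
    using s2(3) by (simp add: Let_def f_def[abs_def] n_def)
  ultimately show ?case by blast
qed

section \<open>Invariants of loops\<close>

definition setR :: "nat \<Rightarrow> nat \<Rightarrow> state \<Rightarrow> state" where
  "setR x a s = ((fst s)(x := a), snd s)"

lemma sem_Assign: "sem (Assign x e) s = setR x (eval e s) s"
  by (simp add: setR_def)

text \<open>The Hoare rule for loops. The last premise accounts for the final value \<open>n\<close>
  of the loop variable.\<close>

lemma sem_For_invariant: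
  assumes "P 0 s" "1 \<notin> writes c" "x \<noteq> 1" "fst s 1 = n"
    and "\<And>i s'. i < n \<Longrightarrow> fst s' 1 = n \<Longrightarrow> P i s' \<Longrightarrow> P (Suc i) (sem c (setR x i s'))"
    and "\<And>s'. P n s' \<Longrightarrow> P n (setR x n s')"
  shows "P n (sem (For x c) s)"
proof -
  let ?f = "\<lambda>i s. sem c ((fst s)(x := i), snd s)"
  have "fst (fold ?f [0..<n] s) 1 = n \<and> P n (fold ?f [0..<n] s)"
  proof (rule fold_invariant_nat[where P = "\<lambda>i s'. fst s' 1 = n \<and> P i s'"])
    show "fst s 1 = n \<and> P 0 s" using assms(1,4) by simp
    fix i s' assume "i < n" "fst s' 1 = n \<and> P i s'"
    then show "fst (?f i s') 1 = n \<and> P (Suc i) (?f i s')"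
      using assms(5)[of i s'] sem_frame[OF assms(2)] assms(3) by (simp add: setR_def)
  qed
  then have "P n (fold ?f [0..<n] s)" by blast
  then show ?thesis using assms(6)[of "fold ?f [0..<n] s"] assms(4)
    by (simp add: Let_def setR_def)
qed

declare sem.simps(2,6) [simp del]

lemma poly_nat_mono: "x \<le> y \<Longrightarrow> poly p x \<le> poly p (y::nat)"
  by (induction p) (auto intro: add_mono mult_mono)

section \<open>The program\<close>

text \<open>The machine cannot multiply, but a factor fixed in the program can be unrolled into
  additions.\<close>

fun mulc :: "nat \<Rightarrow> expr \<Rightarrow> expr" where
  "mulc 0 e = Const 0"
| "mulc (Suc j) e = Add e (mulc j e)"

lemma eval_mulc [simp]: "eval (mulc j e) s = j * eval e s"
  by (induction j) auto

lemma wf_mulc [simp]: "expr_wf D e \<Longrightarrow> expr_wf D (mulc j e)"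
  by (induction j) auto

text \<open>With nonzero as truth, \<open>Add\<close> is disjunction, truncated \<open>Sub\<close>
  is strict comparison, and subtraction from 1 is negation.\<close>

definition holds :: "expr \<Rightarrow> state \<Rightarrow> bool" where "holds e s \<longleftrightarrow> eval e s \<noteq> 0"

definition Not_expr :: "expr \<Rightarrow> expr" where "Not_expr e = Sub (Const 1) e"
definition Conj_expr :: "expr \<Rightarrow> expr \<Rightarrow> expr" where
  "Conj_expr e f = Not_expr (Add (Not_expr e) (Not_expr f))"
definition Eq_expr :: "expr \<Rightarrow> expr \<Rightarrow> expr" where
  "Eq_expr e f = Not_expr (Add (Sub e f) (Sub f e))"

fun All_expr :: "(nat \<Rightarrow> expr) \<Rightarrow> nat \<Rightarrow> expr" where
  "All_expr f 0 = Const 1"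
| "All_expr f (Suc j) = Conj_expr (All_expr f j) (f j)"

fun Ex_expr :: "(nat \<Rightarrow> expr) \<Rightarrow> nat \<Rightarrow> expr" where
  "Ex_expr f 0 = Const 0"
| "Ex_expr f (Suc j) = Add (Ex_expr f j) (f j)"

lemma holds_simps [simp]:
  "holds (Const a) s \<longleftrightarrow> a \<noteq> 0"
  "holds (Add e f) s \<longleftrightarrow> holds e s \<or> holds f s"
  "holds (Sub e f) s \<longleftrightarrow> eval f s < eval e s"
  "holds (Not_expr e) s \<longleftrightarrow> \<not> holds e s"
  "holds (Conj_expr e f) s \<longleftrightarrow> holds e s \<and> holds f s"
  "holds (Eq_expr e f) s \<longleftrightarrow> eval e s = eval f s"
  by (auto simp: holds_def Not_expr_def Conj_expr_def Eq_expr_def)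

lemma holds_All [simp]: "holds (All_expr f j) s \<longleftrightarrow> (\<forall>i<j. holds (f i) s)"
  by (induction j) (auto simp: less_Suc_eq)

lemma holds_Ex [simp]: "holds (Ex_expr f j) s \<longleftrightarrow> (\<exists>i<j. holds (f i) s)"
  by (induction j) (auto simp: less_Suc_eq)

lemma wf_bool_expr [simp]:
  "expr_wf D (Not_expr e) \<longleftrightarrow> expr_wf D e"
  "expr_wf D (Conj_expr e f) \<longleftrightarrow> expr_wf D e \<and> expr_wf D f"
  "expr_wf D (Eq_expr e f) \<longleftrightarrow> expr_wf D e \<and> expr_wf D f"
  by (auto simp: Not_expr_def Conj_expr_def Eq_expr_def)

lemma wf_quant_expr [simp]:
  "(\<And>i. i < j \<Longrightarrow> expr_wf D (f i)) \<Longrightarrow> expr_wf D (All_expr f j)"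
  "(\<And>i. i < j \<Longrightarrow> expr_wf D (f i)) \<Longrightarrow> expr_wf D (Ex_expr f j)"
  by (induction j) auto

text \<open>Used for iteration over the colors. The unrolled index is a constant of the program and
  can therefore select guess registers.\<close>

fun repeat :: "(nat \<Rightarrow> cmd) \<Rightarrow> nat \<Rightarrow> cmd" where
  "repeat f 0 = Skip"
| "repeat f (Suc j) = (repeat f j ;; f (Suc j))"

lemma repeat_invariant:
  assumes "P 0 s" "\<And>j s. j < k \<Longrightarrow> P j s \<Longrightarrow> P (Suc j) (sem (f (Suc j)) s)"
  shows "P k (sem (repeat f k) s)"
proof -
  have "j \<le> k \<Longrightarrow> P j (sem (repeat f j) s)" for j using assms by (induction j) auto
  then show ?thesis by simp
qed

lemma writes_repeat: "(\<And>j. writes (f j) \<subseteq> A) \<Longrightarrow> writes (repeat f k) \<subseteq> A"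
  by (induction k) auto

lemma wf_repeat: "(\<And>j. 0 < j \<Longrightarrow> j \<le> k \<Longrightarrow> cmd_wf D (f j)) \<Longrightarrow> cmd_wf D (repeat f k)"
  by (induction k) auto

lemma sem_If: "sem (If e c d) s = (if holds e s then sem c s else sem d s)"
  by (simp add: holds_def)

declare sem.simps(5) [simp del]

lemma fst_setR: "fst (setR x a s) y = (if y = x then a else fst s y)"
  by (simp add: setR_def)

lemma snd_setR [simp]: "snd (setR x a s) = snd s"
  by (simp add: setR_def)

text \<open>
  Registers: 0 base of the work memory, 1 number \<open>n\<close> of vertices, 2 answer, 3 position of the lists
  in the input, 4 and 5 pass counters, 6 and 7 vertices \<open>v\<close> and \<open>u\<close>, 8 and 9 best color and its
  label, 10 flag, from 11 on the guessed vertices. The work memory has \<open>2 * k + 2\<close> cells for each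
  vertex: cell \<open>0\<close> is the current color, cell \<open>c\<close> the label of color \<open>c\<close>, cell \<open>k + c\<close>
  tells whether \<open>c\<close> is in the reduced list, and cell \<open>2 * k + 1\<close> is the position of the row of the
  adjacency matrix.
\<close>

definition addr :: "nat \<Rightarrow> expr \<Rightarrow> expr \<Rightarrow> expr" where
  "addr k j v = Add (Var 0) (Add (mulc (2 * k + 2) v) j)"

definition cell :: "nat \<Rightarrow> expr \<Rightarrow> expr \<Rightarrow> expr" where
  "cell k j v = Mem (addr k j v)"

text \<open>The row start depends on the product \<open>n * u\<close>, which no expression computes;
  hence the table built by \<open>init_rows\<close>.\<close>

definition adj :: "nat \<Rightarrow> expr \<Rightarrow> expr \<Rightarrow> expr" where
  "adj k u v = Mem (Add (cell k (Const (2 * k + 1)) u) v)"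

text \<open>Register 3 runs through the row starts, beginning behind the unary prefix and its end
  mark, and stops where the lists begin.\<close>

definition init_rows :: "nat \<Rightarrow> cmd" where
  "init_rows k = (Assign 3 (Add (Var 1) (Const 1)) ;;
     For 6 (Store (addr k (Const (2 * k + 1)) (Var 6)) (Var 3) ;; Assign 3 (Add (Var 3) (Var 1))))"

text \<open>Color \<open>c\<close> has two consecutive blocks of \<open>m\<close> guesses, block
  \<open>2 * c\<close> for \<open>T\<close> and block \<open>2 * c + 1\<close> for
  \<open>X\<close>.\<close>

definition guessT :: "nat \<Rightarrow> nat \<Rightarrow> nat \<Rightarrow> nat" where "guessT m c j = 2 * c * m + j"
definition guessX :: "nat \<Rightarrow> nat \<Rightarrow> nat \<Rightarrow> nat" where "guessX m c j = (2 * c + 1) * m + j"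

definition guesses :: "nat \<Rightarrow> nat \<Rightarrow> nat" where "guesses k m = (2 * k + 2) * m"

text \<open>The input bit of \<open>c\<close>, at offset \<open>c - 1\<close> because colors start
  with 1, combined with the test for \<open>container\<close>; its disjunction is the
  \<open>Add\<close>.\<close>

definition in_list :: "nat \<Rightarrow> nat \<Rightarrow> nat \<Rightarrow> expr" where
  "in_list k m c = Conj_expr (Mem (Add (Var 3) (Add (mulc k (Var 6)) (Const (c - 1)))))
     (Conj_expr (All_expr (\<lambda>j. Not_expr (adj k (Var 6) (Var (11 + guessT m c j)))) m)
       (Add (Ex_expr (\<lambda>j. Eq_expr (Var 6) (Var (11 + guessT m c j))) m)
         (All_expr (\<lambda>j. Conj_expr (Not_expr (Eq_expr (Var 6) (Var (11 + guessX m c j))))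
           (Not_expr (adj k (Var 6) (Var (11 + guessX m c j))))) m)))"

definition init_vertex :: "nat \<Rightarrow> nat \<Rightarrow> cmd" where
  "init_vertex k m = (Store (addr k (Const 0) (Var 6)) (Const 0) ;;
     repeat (\<lambda>c. Store (addr k (Const c) (Var 6)) (Const 0) ;;
       Store (addr k (Const (k + c)) (Var 6)) (in_list k m c)) k)"

text \<open>Register 8 stays 0 if the reduced list is empty; \<open>step\<close> then leaves the
  vertex uncolored.\<close>

definition find_best :: "nat \<Rightarrow> cmd" where
  "find_best k = (Assign 8 (Const 0) ;;
     repeat (\<lambda>c. If (Conj_expr (cell k (Const (k + c)) (Var 6))
         (Add (Not_expr (Var 8)) (Sub (Var 9) (cell k (Const c) (Var 6)))))
       (Assign 8 (Const c) ;; Assign 9 (cell k (Const c) (Var 6))) Skip) k)"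

text \<open>The label rises at every neighbor of \<open>v\<close>, even where the color is not
  listed; \<open>bid\<close> looks at labels of listed colors only.\<close>

definition update :: "nat \<Rightarrow> cmd" where
  "update k = If (Eq_expr (Var 7) (Var 6))
     (Store (addr k (Const 0) (Var 7)) (Var 8) ;;
      Store (addr k (Var 8) (Var 7)) (Add (cell k (Var 8) (Var 7)) (Const 1)))
     (If (adj k (Var 6) (Var 7))
       (If (Eq_expr (cell k (Const 0) (Var 7)) (Var 8))
          (Store (addr k (Const 0) (Var 7)) (Const 0)) Skip ;;
        Store (addr k (Var 8) (Var 7)) (Add (cell k (Var 8) (Var 7)) (Const 1)))
       Skip)"

definition step :: "nat \<Rightarrow> cmd" where
  "step k = If (cell k (Const 0) (Var 6)) Skip
     (find_best k ;; If (Var 8) (For 7 (update k)) Skip)"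

text \<open>The answer register is set but never cleared, so success with one guess survives the
  later ones.\<close>

definition check :: "nat \<Rightarrow> cmd" where
  "check k = (Assign 10 (Const 1) ;;
     For 6 (If (cell k (Const 0) (Var 6)) Skip (Assign 10 (Const 0))) ;;
     If (Var 10) (Assign 2 (Const 1)) Skip)"

text \<open>The nested loops make \<open>n * n\<close> passes. For a feasible guess, a pass that
  starts with an uncolored vertex makes at least one bid.\<close>

definition try_guess :: "nat \<Rightarrow> nat \<Rightarrow> cmd" where
  "try_guess k m = (For 6 (init_vertex k m) ;; For 4 (For 5 (For 6 (step k))) ;; check k)"

text \<open>The guess registers are the loop variables. The nesting depth will depend on
  \<open>k\<close> and \<open>r\<close> only, which keeps the running time polynomial.\<close>

fun guess_loops :: "nat \<Rightarrow> cmd \<Rightarrow> cmd" where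
  "guess_loops 0 c = c"
| "guess_loops (Suc j) c = For (11 + j) (guess_loops j c)"

text \<open>Truncated \<open>1 - n\<close> answers yes for the empty graph, where no loop makes a
  pass.\<close>

definition solve :: "nat \<Rightarrow> nat \<Rightarrow> cmd" where
  "solve k m = (init_rows k ;; Assign 2 (Sub (Const 1) (Var 1)) ;;
     guess_loops (guesses k m) (try_guess k m) ;; Assign 0 (Var 2))"

lemma guess_bounds: "c \<le> k \<Longrightarrow> j < m \<Longrightarrow> guessT m c j < guesses k m \<and> guessX m c j < guesses k m"
proof -
  assume "c \<le> k" "j < m"
  then have "(2 * c + 1) * m + j < (2 * c + 1) * m + m" by simp
  also have "\<dots> = (2 * c + 2) * m" by simp
  also have "\<dots> \<le> (2 * k + 2) * m" using \<open>c \<le> k\<close> by (intro mult_right_mono) auto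
  finally show ?thesis by (auto simp: guessT_def guessX_def guesses_def)
qed

lemma wf_addr [simp]: "0 < D \<Longrightarrow> expr_wf D j \<Longrightarrow> expr_wf D v \<Longrightarrow> expr_wf D (addr k j v)"
  by (simp add: addr_def)

lemma wf_cell [simp]: "0 < D \<Longrightarrow> expr_wf D j \<Longrightarrow> expr_wf D v \<Longrightarrow> expr_wf D (cell k j v)"
  by (simp add: cell_def)

lemma wf_adj [simp]: "0 < D \<Longrightarrow> expr_wf D u \<Longrightarrow> expr_wf D v \<Longrightarrow> expr_wf D (adj k u v)"
  by (simp add: adj_def)

lemma writes_update: "writes (update k) = {}"
  by (simp add: update_def)

lemma writes_find_best: "writes (find_best k) \<subseteq> {8, 9}"
  using writes_repeat[of _ "{8, 9}"] by (auto simp: find_best_def)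

lemma writes_step: "writes (step k) \<subseteq> {7, 8, 9}"
  using writes_find_best by (auto simp: step_def writes_update)

lemma writes_init_vertex: "writes (init_vertex k m) = {}"
  using writes_repeat[of _ "{}"] by (auto simp: init_vertex_def)

lemma writes_try_guess: "writes (try_guess k m) \<subseteq> {2, 4, 5, 6, 7, 8, 9, 10}"
  using writes_step[of k] by (auto simp: try_guess_def check_def writes_init_vertex)

lemma writes_guess_loops: "writes (guess_loops j c) \<subseteq> writes c \<union> {11..<11 + j}"
  by (induction j) auto

lemma wf_in_list:
  assumes "c \<le> k" shows "expr_wf (11 + guesses k m) (in_list k m c)"
  using guess_bounds[OF assms] by (simp add: in_list_def)

lemma wf_try_guess: "cmd_wf (11 + guesses k m) (try_guess k m)"
proof -
  have "cmd_wf (11 + guesses k m) (init_vertex k m)"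
    unfolding init_vertex_def by (auto intro!: wf_repeat wf_in_list)
  moreover have "cmd_wf (11 + guesses k m) (step k)"
    unfolding step_def find_best_def update_def by (auto intro!: wf_repeat)
  ultimately show ?thesis
    using writes_step[of k] by (auto simp: try_guess_def check_def writes_init_vertex)
qed

lemma wf_guess_loops:
  "cmd_wf (11 + i) c \<Longrightarrow> writes c \<subseteq> {..10} \<Longrightarrow> j \<le> i \<Longrightarrow> cmd_wf (11 + i) (guess_loops j c)"
  using writes_guess_loops by (induction j) fastforce+

lemma wf_solve: "cmd_wf (11 + guesses k m) (solve k m)"
proof -
  have "writes (try_guess k m) \<subseteq> {..10}" using writes_try_guess[of k m] by auto
  from wf_guess_loops[OF wf_try_guess this order_refl] show ?thesis
    unfolding solve_def init_rows_def by auto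
qed

declare sem.simps(3) [simp del]

section \<open>Memory layout and initialization\<close>

locale solver =
  fixes k m n N :: nat and inp :: "nat \<Rightarrow> nat" and E :: "nat rel2" and LL :: "nat \<Rightarrow> nat set"
  assumes space: "n + 1 + n * n + n * k \<le> N"
    and E_sym: "E u v \<Longrightarrow> E v u" and E_irrefl: "\<not> E u u"
    and inp_adj: "u < n \<Longrightarrow> v < n \<Longrightarrow> inp (n + 1 + n * u + v) \<noteq> 0 \<longleftrightarrow> E u v"
    and inp_list: "v < n \<Longrightarrow> c \<in> {1..k} \<Longrightarrow>
      inp (n + 1 + n * n + (k * v + (c - 1))) \<noteq> 0 \<longleftrightarrow> c \<in> LL v"
begin

text \<open>\<open>N\<close> lies beyond the encoded instance, so the work cells never overlap
  it.\<close>

definition pos :: "nat \<Rightarrow> nat \<Rightarrow> nat" where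
  "pos j v = N + ((2 * k + 2) * v + j)"

definition fld :: "state \<Rightarrow> nat \<Rightarrow> nat \<Rightarrow> nat" where
  "fld s j v = snd s (pos j v)"

definition setM :: "nat \<Rightarrow> nat \<Rightarrow> nat \<Rightarrow> state \<Rightarrow> state" where
  "setM j v a s = (fst s, (snd s)(pos j v := a))"

definition env :: "state \<Rightarrow> bool" where
  "env s \<longleftrightarrow> fst s 0 = N \<and> fst s 1 = n \<and> fst s 3 = n + 1 + n * n \<and>
     (\<forall>u<n. fld s (2 * k + 1) u = n + 1 + n * u) \<and> (\<forall>i<N. snd s i = inp i)"

lemma pos_eq_iff:
  assumes "j \<le> 2 * k + 1" "j' \<le> 2 * k + 1"
  shows "pos j v = pos j' v' \<longleftrightarrow> j = j' \<and> v = v'"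
proof
  assume "pos j v = pos j' v'"
  then have *: "(2 * k + 2) * v + j = (2 * k + 2) * v' + j'" by (simp add: pos_def)
  have "b = (a * b + i) div a" if "i < a" for a b i :: nat using that by simp
  from this[of j "2 * k + 2" v] this[of j' "2 * k + 2" v'] have "v = v'"
    using assms unfolding * by linarith
  then show "j = j' \<and> v = v'" using * by simp
qed simp

lemma fst_setM [simp]: "fst (setM j v a s) = fst s"
  by (simp add: setM_def)

lemma fld_setM:
  "j \<le> 2 * k + 1 \<Longrightarrow> j' \<le> 2 * k + 1 \<Longrightarrow>
    fld (setM j v a s) j' v' = (if j' = j \<and> v' = v then a else fld s j' v')"
  using pos_eq_iff by (auto simp: setM_def fld_def)

lemma snd_setM: "i < N \<Longrightarrow> snd (setM j v a s) i = snd s i"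
  by (simp add: setM_def pos_def)

lemma fld_setR [simp]: "fld (setR x a s) = fld s"
  by (simp add: fld_def fun_eq_iff)

lemma env_setM: "env s \<Longrightarrow> j \<le> 2 * k \<Longrightarrow> env (setM j v a s)"
  by (auto simp: env_def fld_setM snd_setM)

lemma env_setR: "env s \<Longrightarrow> x \<notin> {0, 1, 3} \<Longrightarrow> env (setR x a s)"
  by (auto simp: env_def fst_setR)

lemma eval_addr: "fst s 0 = N \<Longrightarrow> eval (addr k j v) s = pos (eval j s) (eval v s)"
  by (simp add: addr_def pos_def)

lemma sem_Store: "fst s 0 = N \<Longrightarrow>
    sem (Store (addr k j v) e) s = setM (eval j s) (eval v s) (eval e s) s"
  by (simp add: sem.simps(3) eval_addr setM_def)

lemma eval_cell: "fst s 0 = N \<Longrightarrow> eval (cell k j v) s = fld s (eval j s) (eval v s)"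
  by (simp add: cell_def eval_addr fld_def)

lemma holds_adj:
  assumes "env s" "eval u s < n" "eval v s < n"
  shows "holds (adj k u v) s \<longleftrightarrow> E (eval u s) (eval v s)"
proof -
  have "n * eval u s + eval v s < n * n"
  proof -
    have "n * eval u s + eval v s < n * eval u s + n" using assms(3) by simp
    also have "\<dots> = n * Suc (eval u s)" by simp
    also have "\<dots> \<le> n * n" using assms(2) by (intro mult_left_mono) auto
    finally show ?thesis .
  qed
  then have "n + 1 + n * eval u s + eval v s < N" using space by simp
  moreover have "eval (adj k u v) s = snd s (n + 1 + n * eval u s + eval v s)"
    using assms by (simp add: adj_def eval_cell env_def)
  ultimately show ?thesis using assms inp_adj by (simp add: holds_def env_def)
qed

lemma holds_input_list:
  assumes "env s" "fst s 6 = v" "v < n" "c \<in> {1..k}"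
  shows "holds (Mem (Add (Var 3) (Add (mulc k (Var 6)) (Const (c - 1))))) s \<longleftrightarrow> c \<in> LL v"
proof -
  have "k * v + (c - 1) < n * k"
  proof -
    have "k * v + (c - 1) < k * v + k" using assms(4) by auto
    also have "\<dots> = k * Suc v" by simp
    also have "\<dots> \<le> k * n" using assms(3) by (intro mult_left_mono) auto
    finally show ?thesis by (simp add: mult.commute)
  qed
  then have "n + 1 + n * n + (k * v + (c - 1)) < N" using space by simp
  then show ?thesis using assms inp_list by (simp add: holds_def env_def)
qed

lemma init_rows_env:
  assumes "fst s 0 = N" "fst s 1 = n" "\<forall>i<N. snd s i = inp i"
  shows "env (sem (init_rows k) s)"
proof -
  let ?c = "Store (addr k (Const (2 * k + 1)) (Var 6)) (Var 3) ;; Assign 3 (Add (Var 3) (Var 1))"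
  define P where "P i s \<longleftrightarrow> fst s 0 = N \<and> fst s 1 = n \<and> fst s 3 = n + 1 + n * i \<and>
    (\<forall>u<i. fld s (2 * k + 1) u = n + 1 + n * u) \<and> (\<forall>i<N. snd s i = inp i)" for i s
  define s1 where "s1 = sem (Assign 3 (Add (Var 1) (Const 1))) s"
  have "P n (sem (For 6 ?c) s1)"
  proof (rule sem_For_invariant[where P = P])
    show "P 0 s1" "fst s1 1 = n" using assms by (auto simp: P_def s1_def sem_Assign fst_setR)
    fix i s' assume i: "i < n" "P i s'"
    let ?s = "setR 6 i s'"
    have "sem ?c ?s = setR 3 (fst ?s 3 + fst ?s 1) (setM (2 * k + 1) i (fst ?s 3) ?s)"
      using i by (simp add: sem_Store sem_Assign fst_setR P_def)
    then show "P (Suc i) (sem ?c ?s)"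
      using i by (auto simp: P_def fst_setR fld_setM snd_setM less_Suc_eq)
  qed (auto simp: P_def fst_setR)
  then show ?thesis by (auto simp: init_rows_def s1_def P_def env_def)
qed

definition guessed :: "(nat \<Rightarrow> nat) \<Rightarrow> state \<Rightarrow> bool" where
  "guessed g s \<longleftrightarrow> (\<forall>i<guesses k m. fst s (11 + i) = g i)"

definition Tset :: "(nat \<Rightarrow> nat) \<Rightarrow> nat \<Rightarrow> nat set" where
  "Tset g c = (\<lambda>j. g (guessT m c j)) ` {..<m}"
definition Xset :: "(nat \<Rightarrow> nat) \<Rightarrow> nat \<Rightarrow> nat set" where
  "Xset g c = (\<lambda>j. g (guessX m c j)) ` {..<m}"

definition reduced :: "(nat \<Rightarrow> nat) \<Rightarrow> nat \<Rightarrow> nat set" where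
  "reduced g v = {c \<in> {1..k}. c \<in> LL v \<and> v \<in> container E {..<n} (Tset g c) (Xset g c)}"

definition lists_ok :: "(nat \<Rightarrow> nat) \<Rightarrow> nat \<Rightarrow> state \<Rightarrow> bool" where
  "lists_ok g i s \<longleftrightarrow> (\<forall>v<i. \<forall>c\<in>{1..k}. fld s (k + c) v \<noteq> 0 \<longleftrightarrow> c \<in> reduced g v)"

lemma holds_in_list:
  assumes "env s" "guessed g s" "\<forall>i<guesses k m. g i < n" "fst s 6 = v" "v < n" "c \<in> {1..k}"
  shows "holds (in_list k m c) s \<longleftrightarrow> c \<in> reduced g v"
proof -
  have c: "c \<le> k" using assms(6) by auto
  have g: "fst s (11 + guessT m c j) = g (guessT m c j)" "g (guessT m c j) < n"
    "fst s (11 + guessX m c j) = g (guessX m c j)" "g (guessX m c j) < n" if "j < m" for j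
    using guess_bounds[OF c that] assms(2,3) by (auto simp: guessed_def)
  have "holds (adj k (Var 6) (Var (11 + guessT m c j))) s \<longleftrightarrow> E v (g (guessT m c j))"
    "holds (adj k (Var 6) (Var (11 + guessX m c j))) s \<longleftrightarrow> E v (g (guessX m c j))" if "j < m" for j
    using holds_adj[OF assms(1), of "Var 6" "Var (11 + guessT m c j)"]
      holds_adj[OF assms(1), of "Var 6" "Var (11 + guessX m c j)"] g[OF that] assms(4,5) by simp_all
  then show ?thesis
    unfolding in_list_def using holds_input_list[OF assms(1,4-6)] g assms(4,5,6)
    by (auto simp: reduced_def container_def Tset_def Xset_def)
qed

lemma guessed_frame:
  "guessed g s \<Longrightarrow> writes c \<subseteq> {..10} \<Longrightarrow> guessed g (sem c s)"
proof -
  assume g: "guessed g s" and "writes c \<subseteq> {..10}"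
  then have "11 + i \<notin> writes c" for i by auto
  then show ?thesis using g by (simp add: guessed_def sem_frame)
qed

lemma init_vertices:
  assumes "env s" "guessed g s" "\<forall>i<guesses k m. g i < n"
  defines "s' \<equiv> sem (For 6 (init_vertex k m)) s"
  shows "env s'" "lists_ok g n s'" "\<And>v j. v < n \<Longrightarrow> j \<le> k \<Longrightarrow> fld s' j v = 0"
proof -
  define P where "P i s \<longleftrightarrow> env s \<and> guessed g s \<and> lists_ok g i s \<and>
    (\<forall>v<i. \<forall>j\<le>k. fld s j v = 0)" for i s
  have "P n s'"
    unfolding s'_def
  proof (rule sem_For_invariant[where P = P])
    fix i s1 assume i: "i < n" "P i s1"
    let ?c = "\<lambda>c. Store (addr k (Const c) (Var 6)) (Const 0) ;;
       Store (addr k (Const (k + c)) (Var 6)) (in_list k m c)"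
    let ?Q = "\<lambda>j s. P i s \<and> fst s 6 = i \<and>
      (\<forall>c\<in>{1..j}. fld s (k + c) i \<noteq> 0 \<longleftrightarrow> c \<in> reduced g i) \<and> (\<forall>c\<le>j. fld s c i = 0)"
    have "?Q k (sem (repeat ?c k) (setM 0 i 0 (setR 6 i s1)))"
    proof (rule repeat_invariant[where P = ?Q])
      show "?Q 0 (setM 0 i 0 (setR 6 i s1))"
        using i by (auto simp: P_def env_setM env_setR guessed_def fst_setR lists_ok_def fld_setM)
      fix j s2 assume j: "j < k" and Q: "?Q j s2"
      let ?s3 = "setM (Suc j) i 0 s2"
      let ?s4 = "setM (k + Suc j) i (eval (in_list k m (Suc j)) ?s3) ?s3"
      have e3: "env ?s3" using Q j by (auto simp: P_def env_setM)
      have "fst s2 0 = N" using Q by (auto simp: P_def env_def)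
      then have s4: "sem (?c (Suc j)) s2 = ?s4"
        using Q by (simp add: sem_Store)
      have e4: "env ?s4" using e3 j by (auto simp: env_setM)
      have "holds (in_list k m (Suc j)) ?s3 \<longleftrightarrow> Suc j \<in> reduced g i"
        using Q j i e3 by (intro holds_in_list assms(3)) (auto simp: P_def guessed_def)
      then show "?Q (Suc j) (sem (?c (Suc j)) s2)"
        unfolding s4 using Q j e4 i
        by (auto simp: P_def guessed_def lists_ok_def fld_setM holds_def le_Suc_eq atLeastAtMostSuc_conv)
    qed
    moreover have "sem (init_vertex k m) (setR 6 i s1) = sem (repeat ?c k) (setM 0 i 0 (setR 6 i s1))"
      using i by (simp add: init_vertex_def P_def env_def sem_Store fst_setR)
    ultimately show "P (Suc i) (sem (init_vertex k m) (setR 6 i s1))"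
      by (auto simp: P_def lists_ok_def less_Suc_eq)
  qed (use assms in \<open>auto simp: P_def lists_ok_def writes_init_vertex env_setR guessed_def fst_setR env_def\<close>)
  then show "env s'" "lists_ok g n s'" "\<And>v j. v < n \<Longrightarrow> j \<le> k \<Longrightarrow> fld s' j v = 0"
    by (auto simp: P_def)
qed

end

section \<open>The auction for a fixed guess\<close>

locale guess = solver +
  fixes g :: "nat \<Rightarrow> nat"
  assumes g_less: "i < guesses k m \<Longrightarrow> g i < n"

text \<open>Reduced lists lie in \<open>1..k\<close>, which leaves 0 to mean uncolored.\<close>

sublocale guess \<subseteq> auction E "{..<n}" "reduced g"
  by unfold_locales (auto simp: E_irrefl reduced_def intro: E_sym)

context guess
begin

definition ready :: "state \<Rightarrow> bool" where
  "ready s \<longleftrightarrow> env s \<and> guessed g s \<and> lists_ok g n s"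

lemma fld_cong: "snd s' = snd s \<Longrightarrow> fld s' = fld s"
  by (simp add: fld_def fun_eq_iff)

lemma find_best_spec:
  assumes s: "ready s" "fst s 6 = v" "v < n"
  defines "s' \<equiv> sem (find_best k) s"
  shows "snd s' = snd s" "\<And>x. x \<notin> {8, 9} \<Longrightarrow> fst s' x = fst s x"
    "fst s' 8 = 0 \<and> reduced g v = {} \<or>
     fst s' 8 \<in> reduced g v \<and> (\<forall>d\<in>reduced g v. fld s (fst s' 8) v \<le> fld s d v)"
proof -
  define Q where "Q j t \<longleftrightarrow> snd t = snd s \<and> (\<forall>x. x \<notin> {8, 9} \<longrightarrow> fst t x = fst s x) \<and>
    (fst t 8 = 0 \<and> reduced g v \<inter> {1..j} = {} \<or>
     fst t 8 \<in> reduced g v \<inter> {1..j} \<and> fst t 9 = fld s (fst t 8) v \<and>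
       (\<forall>d\<in>reduced g v \<inter> {1..j}. fld s (fst t 8) v \<le> fld s d v))" for j t
  let ?c = "\<lambda>c. If (Conj_expr (cell k (Const (k + c)) (Var 6))
         (Add (Not_expr (Var 8)) (Sub (Var 9) (cell k (Const c) (Var 6)))))
       (Assign 8 (Const c) ;; Assign 9 (cell k (Const c) (Var 6))) Skip"
  have "Q k (sem (repeat ?c k) (setR 8 0 s))"
  proof (rule repeat_invariant[where P = Q])
    show "Q 0 (setR 8 0 s)" by (auto simp: Q_def fst_setR)
    fix j t assume j: "j < k" and Q: "Q j t"
    let ?j = "Suc j"
    have t: "fst t 0 = N" "fst t 6 = v" "fld t = fld s" "\<And>x. fst (setR 8 x t) 0 = N"
      "\<And>x. fst (setR 8 x t) 6 = v"
    proof -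
      have "snd t = snd s" "fst t 0 = fst s 0" "fst t 6 = fst s 6" using Q by (simp_all add: Q_def)
      moreover have "fst s 0 = N" using s by (simp add: ready_def env_def)
      ultimately show "fst t 0 = N" "fst t 6 = v" "fld t = fld s" "\<And>x. fst (setR 8 x t) 0 = N"
        "\<And>x. fst (setR 8 x t) 6 = v"
        using s(2) fld_cong[of t s] by (simp_all add: fst_setR)
    qed
    have in_red: "fld s (k + ?j) v \<noteq> 0 \<longleftrightarrow> ?j \<in> reduced g v"
    proof -
      have "lists_ok g n s" "?j \<in> {1..k}" using s j by (auto simp: ready_def)
      then show ?thesis using s(3) unfolding lists_ok_def by blast
    qed
    have cond: "holds (Conj_expr (cell k (Const (k + ?j)) (Var 6))
         (Add (Not_expr (Var 8)) (Sub (Var 9) (cell k (Const ?j) (Var 6))))) t \<longleftrightarrow>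
      ?j \<in> reduced g v \<and> (fst t 8 = 0 \<or> fld s ?j v < fst t 9)"
      using t in_red by (simp add: holds_def[of "cell _ _ _"] holds_def[of "Var _"] eval_cell)
    have split: "reduced g v \<inter> {1..?j} =
        (if ?j \<in> reduced g v then insert ?j (reduced g v \<inter> {1..j}) else reduced g v \<inter> {1..j})"
      by (auto simp: le_Suc_eq)
    show "Q ?j (sem (?c ?j) t)"
    proof (cases "?j \<in> reduced g v \<and> (fst t 8 = 0 \<or> fld s ?j v < fst t 9)")
      case True
      then have "sem (?c ?j) t = setR 9 (fld s ?j v) (setR 8 ?j t)"
        using cond t by (simp add: sem_If sem_Assign eval_cell fst_setR)
      moreover have "fld s ?j v \<le> fld s d v" if "d \<in> reduced g v \<inter> {1..j}" for d
      proof -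
        have "fst t 8 \<noteq> 0" "fst t 9 \<le> fld s d v" using Q that by (auto simp: Q_def)
        then show ?thesis using True by simp
      qed
      ultimately show ?thesis using Q True unfolding Q_def split by (auto simp: fst_setR)
    next
      case False
      then have "sem (?c ?j) t = t" using cond by (simp only: sem_If if_False sem.simps)
      then show ?thesis using Q False unfolding Q_def split by auto
    qed
  qed
  moreover have "s' = sem (repeat ?c k) (setR 8 0 s)"
    by (simp add: s'_def find_best_def sem_Assign)
  moreover have "reduced g v \<inter> {1..k} = reduced g v" by (auto simp: reduced_def)
  ultimately show "snd s' = snd s" "\<And>x. x \<notin> {8, 9} \<Longrightarrow> fst s' x = fst s x"
    "fst s' 8 = 0 \<and> reduced g v = {} \<or>
     fst s' 8 \<in> reduced g v \<and> (\<forall>d\<in>reduced g v. fld s (fst s' 8) v \<le> fld s d v)"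
    unfolding Q_def by auto
qed

text \<open>One formula for colors, labels and list cells: \<open>c\<close> is at most
  \<open>k\<close>, so the list cells from \<open>k + 1\<close> on keep their values.\<close>

definition updated :: "nat \<Rightarrow> nat \<Rightarrow> state \<Rightarrow> nat \<Rightarrow> nat \<Rightarrow> nat" where
  "updated v c s j u = (if j = 0 then if u = v then c else if E v u \<and> fld s 0 u = c then 0 else fld s 0 u
     else if j = c \<and> (u = v \<or> E v u) then fld s j u + 1 else fld s j u)"

lemma update_spec:
  assumes s: "env s" "fst s 6 = v" "v < n" "fst s 8 = c" "c \<in> {1..k}"
  defines "s' \<equiv> sem (For 7 (update k)) s"
  shows "env s'" "\<And>j u. j \<le> 2 * k \<Longrightarrow> u < n \<Longrightarrow> fld s' j u = updated v c s j u"
proof -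
  \<comment> \<open>Updating in place is safe: the color and labels read for a vertex are its own,
    so vertices not yet visited still have the old values.\<close>
  define P where "P i t \<longleftrightarrow> env t \<and> fst t 6 = v \<and> fst t 8 = c \<and>
    (\<forall>j\<le>2 * k. \<forall>u<n. fld t j u = (if u < i then updated v c s j u else fld s j u))" for i t
  have "P n s'"
    unfolding s'_def
  proof (rule sem_For_invariant[where P = P])
    fix i t assume i: "i < n" and P: "P i t"
    let ?t = "setR 7 i t"
    have e: "env ?t" "fst ?t 6 = v" "fst ?t 8 = c" "fst ?t 7 = i" "fst ?t 0 = N"
      using P by (auto simp: P_def env_setR fst_setR env_def)
    have adj: "holds (adj k (Var 6) (Var 7)) ?t \<longleftrightarrow> E v i"
      using holds_adj[OF e(1), of "Var 6" "Var 7"] e i s(3) by simp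
    have res: "sem (update k) ?t = (if i = v then setM c i (fld t c i + 1) (setM 0 i c ?t)
      else if E v i then setM c i (fld t c i + 1) (if fld t 0 i = c then setM 0 i 0 ?t else ?t) else ?t)"
    proof -
      have t: "fst t 0 = N" "fst t 6 = v" "fst t 8 = c" using P by (auto simp: P_def env_def)
      show ?thesis
        unfolding update_def sem_If adj using t s(5)
        by (simp add: sem_Store eval_cell fld_setM fst_setR sem_If)
    qed
    have "env (sem (update k) ?t)" unfolding res using P s(5) by (auto simp: P_def env_setM env_setR)
    moreover have "fst (sem (update k) ?t) 6 = v" "fst (sem (update k) ?t) 8 = c"
      unfolding res using P by (auto simp: P_def fst_setR)
    moreover have "fld (sem (update k) ?t) j u = (if u < Suc i then updated v c s j u else fld s j u)"
      if "j \<le> 2 * k" "u < n" for j u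
    proof -
      have t: "fld t j u = (if u < i then updated v c s j u else fld s j u)"
        if "j \<le> 2 * k" "u < n" for j u using P that by (auto simp: P_def)
      have t0: "fld t 0 i = fld s 0 i" "fld t c i = fld s c i" "fld t j i = fld s j i"
        using t[of _ i] i s(5) that by auto
      show ?thesis
      proof (cases "u = i")
        case True
        show ?thesis unfolding res True using t0 that s(5) by (auto simp: fld_setM updated_def)
      next
        case False
        have "fld (sem (update k) ?t) j u = fld t j u"
          unfolding res using that s(5) False by (auto simp: fld_setM)
        then show ?thesis using t[OF that] False by (auto simp: less_Suc_eq)
      qed
    qed
    ultimately show "P (Suc i) (sem (update k) ?t)" by (auto simp: P_def)
  qed (use s in \<open>auto simp: P_def writes_update env_setR fst_setR env_def\<close>)
  then show "env s'" "\<And>j u. j \<le> 2 * k \<Longrightarrow> u < n \<Longrightarrow> fld s' j u = updated v c s j u"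
    by (auto simp: P_def)
qed

text \<open>Here the machine meets the auction. Cell 0 is the color and cell \<open>c\<close> the
  label of \<open>c\<close>, so \<open>fld s 0\<close> and \<open>fld s\<close> are the arguments of
  \<open>bid\<close>.\<close>

lemma step_spec:
  assumes s: "ready s" "fst s 6 = v" "v < n"
  defines "s' \<equiv> sem (step k) s"
  shows "ready s'" "fst s' 6 = v"
    "fld s' = fld s \<and> (fld s 0 v \<noteq> 0 \<or> reduced g v = {}) \<or>
     fld s 0 v = 0 \<and> (\<exists>c. bid v c (fld s 0) (fld s) (fld s' 0) (fld s'))"
proof -
  have N: "fst s 0 = N" using s by (simp add: ready_def env_def)
  have w: "writes (step k) \<subseteq> {..10}" "6 \<notin> writes (step k)" using writes_step[of k] by auto
  have g: "guessed g s'" using guessed_frame[OF _ w(1)] s by (auto simp: s'_def ready_def)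
  show "fst s' 6 = v" using sem_frame[OF w(2)] s by (simp add: s'_def)
  show "ready s'"
    "fld s' = fld s \<and> (fld s 0 v \<noteq> 0 \<or> reduced g v = {}) \<or>
     fld s 0 v = 0 \<and> (\<exists>c. bid v c (fld s 0) (fld s) (fld s' 0) (fld s'))"
  proof (atomize(full), cases "fld s 0 v = 0")
    case False
    then have "s' = s" using N s by (simp add: s'_def step_def sem_If holds_def eval_cell)
    then show "ready s' \<and> (fld s' = fld s \<and> (fld s 0 v \<noteq> 0 \<or> reduced g v = {}) \<or>
     fld s 0 v = 0 \<and> (\<exists>c. bid v c (fld s 0) (fld s) (fld s' 0) (fld s')))" using False s by simp
  next
    case True
    define t where "t = sem (find_best k) s"
    have s': "s' = (if fst t 8 = 0 then t else sem (For 7 (update k)) t)"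
      using True N s by (simp add: s'_def step_def sem_If holds_def eval_cell t_def)
    note fb = find_best_spec[OF s, folded t_def]
    have ft: "fld t = fld s" by (rule fld_cong[OF fb(1)])
    have et: "env t" "fst t 6 = v" using s fb(1,2) ft by (auto simp: ready_def env_def)
    show "ready s' \<and> (fld s' = fld s \<and> (fld s 0 v \<noteq> 0 \<or> reduced g v = {}) \<or>
     fld s 0 v = 0 \<and> (\<exists>c. bid v c (fld s 0) (fld s) (fld s' 0) (fld s')))"
    proof (cases "fst t 8 = 0")
      case True
      then have "s' = t" "reduced g v = {}" using s' fb(3) L0[of v] by auto
      then show ?thesis using ft et g s by (auto simp: ready_def lists_ok_def)
    next
      case False
      define c where "c = fst t 8"
      have c: "c \<in> reduced g v" "\<forall>d\<in>reduced g v. fld s c v \<le> fld s d v"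
        using fb(3) False by (auto simp: c_def)
      then have ck: "c \<in> {1..k}" by (auto simp: reduced_def)
      have eq: "s' = sem (For 7 (update k)) t" using s' False by simp
      note up = update_spec[OF et s(3) c_def[symmetric] ck, folded eq]
      have up': "fld s' j u = updated v c s j u" if "j \<le> 2 * k" "u < n" for j u
        using up(2)[OF that] by (simp add: updated_def ft)
      have "lists_ok g n s'"
        using s ck up' by (auto simp: ready_def lists_ok_def updated_def)
      moreover have "bid v c (fld s 0) (fld s) (fld s' 0) (fld s')"
        unfolding bid_def using c up' by (auto simp: updated_def reduced_def)
      ultimately show ?thesis using \<open>fld s 0 v = 0\<close> up(1) g by (auto simp: ready_def)
    qed
  qed
qed

end

section \<open>Feasible guesses and the progress of the auction\<close>

context solver
begin

definition colorable :: bool where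
  "colorable \<longleftrightarrow> (\<exists>\<phi>. \<forall>u<n. \<phi> u \<in> LL u \<and> (\<forall>w<n. E u w \<longrightarrow> \<phi> w \<noteq> \<phi> u))"

definition feasible :: "(nat \<Rightarrow> nat) \<Rightarrow> bool" where
  "feasible g \<longleftrightarrow>
     (\<exists>\<phi>. \<forall>u<n. \<phi> u \<in> reduced g u \<and> (\<forall>w<n. E u w \<longrightarrow> \<phi> w \<noteq> \<phi> u)) \<and>
     (\<forall>c. P3_free E {v \<in> {..<n}. c \<in> reduced g v})"

definition finished :: "state \<Rightarrow> bool" where
  "finished s \<longleftrightarrow> (\<forall>u<n. fld s 0 u \<noteq> 0)"

end

context guess
begin

text \<open>The partial coloring, kept for every guess, serves soundness. The part under
  \<open>feasible g\<close> serves completeness, with \<open>i\<close> counting passes.\<close>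

definition progress :: "nat \<Rightarrow> state \<Rightarrow> bool" where
  "progress i s \<longleftrightarrow> ready s \<and> partial_coloring (fld s 0) \<and>
     (feasible g \<longrightarrow> auction_inv (fld s 0) (fld s) \<and>
       (finished s \<or> i \<le> potential (fld s 0) (fld s)))"

lemma ready_setR: "ready s \<Longrightarrow> x \<in> {2..10} - {3} \<Longrightarrow> ready (setR x a s)"
  by (auto simp: ready_def env_setR guessed_def fst_setR lists_ok_def)

lemma progress_setR: "progress i s \<Longrightarrow> x \<in> {2..10} - {3} \<Longrightarrow> progress i (setR x a s)"
  using ready_setR by (simp add: progress_def finished_def)

lemma ready_bound: "ready s \<Longrightarrow> fst s (Suc 0) = n"
  by (simp add: ready_def env_def)

lemma progress_pass:
  assumes "progress i s"
  shows "progress (Suc i) (sem (For 6 (step k)) s)"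
proof -
  \<comment> \<open>Within a pass, either a bid has already lifted the potential, or an uncolored
    vertex is still ahead; the latter is impossible at \<open>v = n\<close>.\<close>
  define P where "P v t \<longleftrightarrow> ready t \<and> partial_coloring (fld t 0) \<and>
    (feasible g \<longrightarrow> auction_inv (fld t 0) (fld t) \<and>
      (finished t \<or> Suc i \<le> potential (fld t 0) (fld t) \<or>
       i \<le> potential (fld t 0) (fld t) \<and> (\<exists>u<n. v \<le> u \<and> fld t 0 u = 0)))" for v t
  have "P n (sem (For 6 (step k)) s)"
  proof (rule sem_For_invariant[where P = P])
    show "P 0 s" using assms unfolding P_def progress_def finished_def by auto
    show "fst s 1 = n" using assms by (auto simp: progress_def ready_bound)
    show "1 \<notin> writes (step k)" using writes_step[of k] by auto
    show "P n (setR 6 n t)" if "P n t" for t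
      using that by (simp add: P_def ready_setR finished_def)
    fix v t assume v: "v < n" and P: "P v t"
    let ?t = "setR 6 v t"
    let ?u = "sem (step k) ?t"
    have "ready ?t" using P by (auto simp: P_def intro: ready_setR)
    note st = step_spec[OF this _ v, simplified fst_setR, simplified]
    from st(3) consider
      (same) "fld ?u = fld t" "fld t 0 v \<noteq> 0 \<or> reduced g v = {}"
      | (bid) c where "fld t 0 v = 0" "bid v c (fld t 0) (fld t) (fld ?u 0) (fld ?u)"
      by blast
    then show "P (Suc v) ?u"
    proof cases
      case same
      \<comment> \<open>A feasible guess has no empty reduced list, so a vertex that does not bid is
        colored already.\<close>
      have "fld t 0 v \<noteq> 0" if "feasible g" using that same(2) v by (auto simp: feasible_def)
      then have "Suc v \<le> u" if "feasible g" "v \<le> u" "fld t 0 u = 0" for u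
        using that le_neq_implies_less[of v u] by fastforce
      then show ?thesis using P st(1) unfolding P_def finished_def same(1) by blast
    next
      case (bid c)
      have "partial_coloring (fld ?u 0)" using partial_coloring_bid[OF _ bid(2)] P by (simp add: P_def)
      moreover have "auction_inv (fld ?u 0) (fld ?u) \<and> Suc i \<le> potential (fld ?u 0) (fld ?u)"
        if f: "feasible g"
      proof -
        obtain \<phi> where \<phi>: "\<And>u. u \<in> {..<n} \<Longrightarrow> \<phi> u \<in> reduced g u"
          "\<And>u w. u \<in> {..<n} \<Longrightarrow> w \<in> {..<n} \<Longrightarrow> E u w \<Longrightarrow> \<phi> u \<noteq> \<phi> w"
          and free: "\<And>c. P3_free E {v \<in> {..<n}. c \<in> reduced g v}"
          using f unfolding feasible_def by (metis lessThan_iff)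
        have inv: "auction_inv (fld t 0) (fld t)" using P f by (simp add: P_def)
        have "\<not> finished t" using v bid(1) by (auto simp: finished_def)
        then have "i \<le> potential (fld t 0) (fld t)" using P f by (auto simp: P_def)
        then show ?thesis
          using auction_inv_bid[where \<phi> = \<phi>, OF inv free \<phi> _ bid] v by simp
      qed
      ultimately show ?thesis using st(1) by (simp add: P_def)
    qed
  qed simp
  then show ?thesis by (auto simp: P_def progress_def)
qed

lemma progress_passes:
  assumes "progress 0 s"
  shows "progress (n * n) (sem (For 4 (For 5 (For 6 (step k)))) s)"
proof (rule sem_For_invariant[where P = "\<lambda>i. progress (n * i)"])
  have w: "1 \<notin> writes (step k)" using writes_step[of k] by auto
  have bound: "fst t 1 = n" if "progress i t" for i t
    using that by (simp add: progress_def ready_bound)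
  from w show "1 \<notin> writes (For 5 (For 6 (step k)))" by simp
  show "fst s 1 = n" by (rule bound[OF assms])
  show "progress (n * n) (setR 4 n t)" if "progress (n * n) t" for t
    using that by (rule progress_setR) simp
  fix i t assume "progress (n * i) t"
  then have t: "progress (n * i) (setR 4 i t)" by (rule progress_setR) simp
  have "progress (n * i + n) (sem (For 5 (For 6 (step k))) (setR 4 i t))"
  proof (rule sem_For_invariant[where P = "\<lambda>j. progress (n * i + j)"])
    show "progress (n * i + 0) (setR 4 i t)" using t by simp
    show "fst (setR 4 i t) 1 = n" by (rule bound[OF t])
    show "progress (n * i + n) (setR 5 n u)" if "progress (n * i + n) u" for u
      using that by (rule progress_setR) simp
    show "1 \<notin> writes (For 6 (step k))" using w by simp
    fix j u assume "progress (n * i + j) u"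
    then have "progress (n * i + j) (setR 5 j u)" by (rule progress_setR) simp
    then show "progress (n * i + Suc j) (sem (For 6 (step k)) (setR 5 j u))"
      using progress_pass by simp
  qed simp
  then show "progress (n * Suc i) (sem (For 5 (For 6 (step k))) (setR 4 i t))"
    by (simp add: add.commute)
qed (use assms in simp_all)

text \<open>A potential of \<open>n * n\<close> contradicts \<open>potential_less\<close> while some
  vertex is uncolored.\<close>

lemma progress_finished:
  assumes "progress (n * n) s" "feasible g"
  shows "finished s"
  using assms potential_less[of "fld s 0" "fld s"] by (fastforce simp: progress_def finished_def)

lemma check_spec:
  assumes "ready s"
  shows "env (sem (check k) s)" "fst (sem (check k) s) 2 = (if finished s then 1 else fst s 2)"
proof -
  let ?c = "If (cell k (Const 0) (Var 6)) Skip (Assign 10 (Const 0))"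
  define P where "P i t \<longleftrightarrow> snd t = snd s \<and> (\<forall>x. x \<notin> {6, 10} \<longrightarrow> fst t x = fst s x) \<and>
    (fst t 10 \<noteq> 0 \<longleftrightarrow> (\<forall>u<i. fld s 0 u \<noteq> 0))" for i t
  define s1 where "s1 = sem (For 6 ?c) (setR 10 1 s)"
  have "P n s1"
    unfolding s1_def
  proof (rule sem_For_invariant[where P = P])
    fix i t assume i: "i < n" and P: "P i t"
    have t: "fst t 0 = N" "fld t = fld s"
      using P assms fld_cong[of t s] by (simp_all add: P_def ready_def env_def)
    have "sem ?c (setR 6 i t) = (if fld s 0 i \<noteq> 0 then setR 6 i t else setR 10 0 (setR 6 i t))"
      using t by (simp add: sem_If holds_def eval_cell sem_Assign fst_setR)
    then show "P (Suc i) (sem ?c (setR 6 i t))" using P by (auto simp: P_def fst_setR less_Suc_eq)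
  qed (use assms in \<open>auto simp: P_def fst_setR ready_bound\<close>)
  then have s1: "snd s1 = snd s" "\<And>x. x \<notin> {6, 10} \<Longrightarrow> fst s1 x = fst s x" "fst s1 10 \<noteq> 0 \<longleftrightarrow> finished s"
    by (auto simp: P_def finished_def)
  have eq: "sem (check k) s = (if finished s then setR 2 1 s1 else s1)"
    using s1(3) by (simp add: check_def sem_Assign sem_If holds_def s1_def)
  have "env s1" using assms s1(1,2) fld_cong[OF s1(1)] by (simp add: ready_def env_def)
  then show "env (sem (check k) s)" by (simp add: eq env_setR)
  show "fst (sem (check k) s) 2 = (if finished s then 1 else fst s 2)"
    using s1(2) by (simp add: eq fst_setR)
qed

lemma try_guess_spec:
  assumes "env s" "guessed g s"
  defines "s' \<equiv> sem (try_guess k m) s"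
  shows "env s'" "fst s 2 \<noteq> 0 \<Longrightarrow> fst s' 2 \<noteq> 0" "fst s' 2 \<noteq> 0 \<Longrightarrow> fst s 2 \<noteq> 0 \<or> colorable"
    "feasible g \<Longrightarrow> fst s' 2 \<noteq> 0"
proof -
  define s1 where "s1 = sem (For 6 (init_vertex k m)) s"
  define s2 where "s2 = sem (For 4 (For 5 (For 6 (step k)))) s1"
  have s': "s' = sem (check k) s2" by (simp add: s'_def try_guess_def s1_def s2_def)
  note iv = init_vertices[OF assms(1,2), folded s1_def]
  have "guessed g s1"
    unfolding s1_def by (rule guessed_frame[OF assms(2)]) (simp add: writes_init_vertex)
  then have r1: "ready s1" using iv g_less by (simp add: ready_def)
  have zero: "fld s1 j v = 0" if "v < n" "j \<le> k" for j v using iv(3) g_less that by blast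
  have "auction_inv (fld s1 0) (fld s1)" "partial_coloring (fld s1 0)"
    using zero by (auto simp: auction_inv_def partial_coloring_def reduced_def)
  moreover have "finished s1 \<or> 0 \<le> potential (fld s1 0) (fld s1)" by simp
  ultimately have "progress 0 s1" using r1 by (simp add: progress_def)
  from progress_passes[OF this] have p2: "progress (n * n) s2" by (simp add: s2_def)
  then have r2: "ready s2" by (simp add: progress_def)
  note ch = check_spec[OF r2, folded s']
  show "env s'" by (rule ch(1))
  have "2 \<notin> writes (For 6 (init_vertex k m))" by (simp add: writes_init_vertex)
  moreover have "2 \<notin> writes (For 4 (For 5 (For 6 (step k))))"
    using writes_step[of k] by auto
  ultimately have ans: "fst s2 2 = fst s 2"
    unfolding s2_def s1_def by (metis sem_frame)
  show "fst s 2 \<noteq> 0 \<Longrightarrow> fst s' 2 \<noteq> 0" using ch(2) ans by simp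
  show "feasible g \<Longrightarrow> fst s' 2 \<noteq> 0" using ch(2) progress_finished[OF p2] by simp
  assume "fst s' 2 \<noteq> 0"
  then have "fst s 2 \<noteq> 0 \<or> finished s2" using ch(2) ans by (auto split: if_splits)
  \<comment> \<open>A partial coloring without uncolored vertices is a coloring, and reduced lists
    are contained in the original ones.\<close>
  moreover have "colorable" if "finished s2"
  proof -
    have "fld s2 0 u \<in> LL u \<and> (\<forall>w<n. E u w \<longrightarrow> fld s2 0 w \<noteq> fld s2 0 u)" if "u < n" for u
      using p2 \<open>finished s2\<close> that by (auto simp: progress_def partial_coloring_def finished_def reduced_def)
    then show ?thesis unfolding colorable_def by blast
  qed
  ultimately show "fst s 2 \<noteq> 0 \<or> colorable" by blast
qed

end

section \<open>Enumerating all guesses\<close>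

context solver
begin

lemma guess_loops_sound:
  assumes "j \<le> guesses k m" "env s" "\<And>i. j \<le> i \<Longrightarrow> i < guesses k m \<Longrightarrow> fst s (11 + i) < n"
  defines "s' \<equiv> sem (guess_loops j (try_guess k m)) s"
  shows "env s' \<and> (fst s 2 \<noteq> 0 \<longrightarrow> fst s' 2 \<noteq> 0) \<and> (fst s' 2 \<noteq> 0 \<longrightarrow> fst s 2 \<noteq> 0 \<or> colorable)"
  using assms(1-3) unfolding s'_def
proof (induction j arbitrary: s)
  case 0
  \<comment> \<open>Whatever the guess registers currently hold is taken as the guess.\<close>
  interpret guess k m n N inp E LL "\<lambda>i. fst s (11 + i)"
    by unfold_locales (use 0 in auto)
  show ?case using try_guess_spec[OF "0.prems"(2)] by (auto simp: guessed_def)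
next
  case (Suc j)
  let ?c = "guess_loops j (try_guess k m)"
  let ?P = "\<lambda>i t. env t \<and> (\<forall>i. Suc j \<le> i \<and> i < guesses k m \<longrightarrow> fst t (11 + i) < n) \<and>
    (fst s 2 \<noteq> 0 \<longrightarrow> fst t 2 \<noteq> 0) \<and> (fst t 2 \<noteq> 0 \<longrightarrow> fst s 2 \<noteq> 0 \<or> colorable)"
  have w: "writes ?c \<subseteq> {2, 4, 5, 6, 7, 8, 9, 10} \<union> {11..<11 + j}"
    using writes_guess_loops[of j "try_guess k m"] writes_try_guess[of k m] by blast
  have "?P n (sem (For (11 + j) ?c) s)"
  proof (rule sem_For_invariant[where P = ?P])
    show "1 \<notin> writes ?c" using w by auto
    show "fst s 1 = n" using Suc.prems by (simp add: env_def)
    fix i t assume i: "i < n" and P: "?P i t"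
    let ?t = "setR (11 + j) i t"
    have "env ?t" using P by (simp add: env_setR)
    moreover have "fst ?t (11 + l) < n" if "j \<le> l" "l < guesses k m" for l
      using that i P by (cases "l = j") (auto simp: fst_setR)
    ultimately have IH: "env (sem ?c ?t) \<and> (fst ?t 2 \<noteq> 0 \<longrightarrow> fst (sem ?c ?t) 2 \<noteq> 0) \<and>
      (fst (sem ?c ?t) 2 \<noteq> 0 \<longrightarrow> fst ?t 2 \<noteq> 0 \<or> colorable)"
      using Suc.IH Suc.prems(1) by simp
    have "fst (sem ?c ?t) (11 + l) = fst t (11 + l)" if "Suc j \<le> l" for l
    proof -
      have "11 + l \<notin> writes ?c" using w that by auto
      then show ?thesis using that by (simp add: sem_frame fst_setR)
    qed
    then show "?P (Suc i) (sem ?c ?t)" using IH P by (auto simp: fst_setR)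
  qed (use Suc.prems in \<open>auto simp: env_setR fst_setR\<close>)
  then show ?case by simp
qed

text \<open>The outer loops are supposed to stand at the values of \<open>g\<close>. The loop of
  register \<open>11 + j\<close> succeeds in pass \<open>g j\<close>, and by
  \<open>guess_loops_sound\<close> later passes keep the answer.\<close>

lemma guess_loops_complete:
  assumes g: "\<And>i. i < guesses k m \<Longrightarrow> g i < n" "feasible g"
    and "j \<le> guesses k m" "env s" "\<And>i. j \<le> i \<Longrightarrow> i < guesses k m \<Longrightarrow> fst s (11 + i) = g i"
  shows "fst (sem (guess_loops j (try_guess k m)) s) 2 \<noteq> 0"
  using assms(3-)
proof (induction j arbitrary: s)
  case 0
  interpret guess k m n N inp E LL g
    by unfold_locales (use g in auto)
  show ?case using try_guess_spec(4)[OF "0.prems"(2)] 0 g(2) by (auto simp: guessed_def)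
next
  case (Suc j)
  let ?c = "guess_loops j (try_guess k m)"
  let ?P = "\<lambda>i t. env t \<and> (\<forall>i. Suc j \<le> i \<and> i < guesses k m \<longrightarrow> fst t (11 + i) = g i) \<and>
    (g j < i \<longrightarrow> fst t 2 \<noteq> 0)"
  have w: "writes ?c \<subseteq> {2, 4, 5, 6, 7, 8, 9, 10} \<union> {11..<11 + j}"
    using writes_guess_loops[of j "try_guess k m"] writes_try_guess[of k m] by blast
  have "?P n (sem (For (11 + j) ?c) s)"
  proof (rule sem_For_invariant[where P = ?P])
    show "1 \<notin> writes ?c" using w by auto
    show "fst s 1 = n" using Suc.prems by (simp add: env_def)
    fix i t assume i: "i < n" and P: "?P i t"
    let ?t = "setR (11 + j) i t"
    have e: "env ?t" using P by (simp add: env_setR)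
    have out: "fst ?t (11 + l) < n" if "j \<le> l" "l < guesses k m" for l
      using that i P g(1) by (cases "l = j") (auto simp: fst_setR)
    have S: "env (sem ?c ?t) \<and> (fst ?t 2 \<noteq> 0 \<longrightarrow> fst (sem ?c ?t) 2 \<noteq> 0)"
      using guess_loops_sound[of j ?t] Suc.prems(1) e out by simp
    have "fst (sem ?c ?t) 2 \<noteq> 0" if "i = g j"
    proof (rule Suc.IH)
      show "fst ?t (11 + l) = g l" if "j \<le> l" "l < guesses k m" for l
        using that P \<open>i = g j\<close> by (cases "l = j") (auto simp: fst_setR)
    qed (use e Suc.prems in auto)
    moreover have "fst (sem ?c ?t) (11 + l) = fst t (11 + l)" if "Suc j \<le> l" for l
    proof -
      have "11 + l \<notin> writes ?c" using w that by auto
      then show ?thesis using that by (simp add: sem_frame fst_setR)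
    qed
    ultimately show "?P (Suc i) (sem ?c ?t)" using S P by (auto simp: fst_setR less_Suc_eq)
  qed (use Suc.prems in \<open>auto simp: env_setR fst_setR\<close>)
  then show ?case using g(1)[of j] Suc.prems(1) by simp
qed

lemma solve_spec:
  assumes s: "fst s 0 = N" "fst s 1 = n" "\<forall>i<N. snd s i = inp i"
    and ex: "n > 0 \<Longrightarrow> colorable \<Longrightarrow> \<exists>g. (\<forall>i. g i < n) \<and> feasible g"
  shows "fst (sem (solve k m) s) 0 \<noteq> 0 \<longleftrightarrow> colorable"
proof -
  define s1 where "s1 = setR 2 (1 - n) (sem (init_rows k) s)"
  define s2 where "s2 = sem (guess_loops (guesses k m) (try_guess k m)) s1"
  have e: "env (sem (init_rows k) s)" by (rule init_rows_env[OF s])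
  then have e1: "env s1" "fst s1 2 = 1 - n" by (auto simp: s1_def env_setR fst_setR)
  have "sem (solve k m) s = setR 0 (fst s2 2) s2"
    using e by (simp add: solve_def sem_Assign s2_def s1_def env_def)
  then have eq: "fst (sem (solve k m) s) 0 = fst s2 2" by (simp add: fst_setR)
  have "fst s2 2 \<noteq> 0 \<longrightarrow> fst s1 2 \<noteq> 0 \<or> colorable" "fst s1 2 \<noteq> 0 \<longrightarrow> fst s2 2 \<noteq> 0"
    using guess_loops_sound[of "guesses k m" s1] e1(1) by (simp_all add: s2_def)
  moreover have "colorable" if "n = 0" unfolding colorable_def using that by simp
  moreover have "fst s2 2 \<noteq> 0" if "n > 0" "colorable"
    using ex[OF that] guess_loops_complete[of _ "guesses k m" s1] e1(1) by (auto simp: s2_def)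
  ultimately show ?thesis using e1(2) eq by fastforce
qed

end

section \<open>A coloring yields a feasible guess\<close>

lemma ex_enumeration:
  assumes "finite S" "S \<noteq> {}" "card S \<le> m"
  shows "\<exists>f. f ` {..<m::nat} = S"
proof -
  obtain h where h: "bij_betw h {0..<card S} S" using ex_bij_betw_nat_finite[OF assms(1)] by blast
  \<comment> \<open>Small sets are padded by repeating \<open>a\<close>; this is why the guessed
    sets were made nonempty.\<close>
  obtain a where a: "a \<in> S" using assms(2) by blast
  have "(\<lambda>i. if i < card S then h i else a) ` {..<m} = S"
    using h a assms(3) by (fastforce simp: bij_betw_def image_iff)
  then show ?thesis by blast
qed

text \<open>The containers of the color classes of a coloring supply the guess: each class survives
  in its reduced lists, and each color is confined to a P3-free set.\<close>

lemma (in solver) ex_feasible: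
  assumes m: "m = 2 * r * k + 3 * r + 1" and LL: "\<And>v. v < n \<Longrightarrow> LL v \<subseteq> {1..k}"
    and free: "\<And>ts. P3_family E {..<n} ts \<Longrightarrow> length ts \<le> r"
    and n: "n > 0" and "colorable"
  shows "\<exists>g. (\<forall>i. g i < n) \<and> feasible g"
proof -
  obtain \<phi> where \<phi>: "\<And>u. u < n \<Longrightarrow> \<phi> u \<in> LL u" "\<And>u w. u < n \<Longrightarrow> w < n \<Longrightarrow> E u w \<Longrightarrow> \<phi> w \<noteq> \<phi> u"
    using assms(5) unfolding colorable_def by blast
  define Q where "Q c T X \<longleftrightarrow> T \<subseteq> {..<n} \<and> X \<subseteq> {..<n} \<and> T \<noteq> {} \<and> X \<noteq> {} \<and>
    card T \<le> m \<and> card X \<le> m \<and> {v \<in> {..<n}. \<phi> v = c} \<subseteq> container E {..<n} T X \<and>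
    P3_free E (container E {..<n} T X)" for c T X
  have "\<exists>T X. Q c T X" for c
  proof -
    have "\<phi> v \<in> {1..k}" if "v \<in> {..<n}" for v using \<phi>(1) LL that by blast
    moreover have "\<phi> u \<noteq> \<phi> v" if "u \<in> {..<n}" "v \<in> {..<n}" "E u v" for u v
      using \<phi>(2)[of v u] that E_sym by auto
    ultimately show ?thesis
      using n unfolding m Q_def by (rule_tac color_class_container[of E "{..<n}" \<phi> k r c,
          OF E_sym E_irrefl finite_lessThan _ _ _ free]) blast+
  qed
  then obtain T X where "\<And>c. Q c (T c) (X c)" by metis
  then have T: "\<And>c. T c \<subseteq> {..<n}" "\<And>c. T c \<noteq> {}" "\<And>c. card (T c) \<le> m"
    and X: "\<And>c. X c \<subseteq> {..<n}" "\<And>c. X c \<noteq> {}" "\<And>c. card (X c) \<le> m"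
    and C: "\<And>c. {v \<in> {..<n}. \<phi> v = c} \<subseteq> container E {..<n} (T c) (X c)"
      "\<And>c. P3_free E (container E {..<n} (T c) (X c))"
    unfolding Q_def by blast+
  have "\<exists>f. f ` {..<m} = T c" "\<exists>f. f ` {..<m} = X c" for c
    using ex_enumeration T X by (meson finite_lessThan finite_subset)+
  then obtain t x where t: "\<And>c. t c ` {..<m} = T c" and x: "\<And>c. x c ` {..<m} = X c" by metis
  \<comment> \<open>Inverts the block layout: the parity of \<open>i div m\<close> chooses between
    \<open>T\<close> and \<open>X\<close>, and its half is the color.\<close>
  define g where "g i = (if even (i div m) then t (i div m div 2) (i mod m)
    else x (i div m div 2) (i mod m))" for i
  have mpos: "m > 0" using m by simp
  have div: "(a * m + j) div m = a" "(a * m + j) mod m = j" if "j < m" for a j using that by simp_all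
  have "g (guessT m c j) = t c j" "g (guessX m c j) = x c j" if "j < m" for c j
    using div[OF that, of "2 * c"] div[OF that, of "2 * c + 1"]
    by (simp_all add: g_def guessT_def guessX_def del: mult_Suc add_mult_distrib)
  then have TX: "Tset g c = T c" "Xset g c = X c" for c
    using t[of c] x[of c] by (auto simp: Tset_def Xset_def)
  have "g i < n" for i
  proof -
    have "i mod m < m" using mpos by simp
    moreover have "t c j < n" "x c j < n" if "j < m" for c j
      using t[of c] x[of c] T(1)[of c] X(1)[of c] that by blast+
    ultimately show ?thesis by (simp add: g_def)
  qed
  moreover have "\<phi> u \<in> reduced g u" if "u < n" for u
    using \<phi>(1)[OF that] LL[OF that] C(1)[of "\<phi> u"] that by (auto simp: reduced_def TX)
  moreover have "P3_free E {v \<in> {..<n}. c \<in> reduced g v}" for c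
    by (rule P3_free_mono[OF C(2)[of c]]) (auto simp: reduced_def TX)
  ultimately show ?thesis using \<phi>(2) unfolding feasible_def by blast
qed

section \<open>Induced copies of the three-vertex path\<close>

text \<open>The image of \<open>H\<close> under \<open>f\<close> is the required induced subgraph.
  The isomorphism also needs a map of arcs, which is \<open>map_prod f f\<close>.\<close>

lemma containsI:
  assumes G: "pair_wf_digraph G" and H: "pair_wf_digraph H"
    and f: "inj_on f (pverts H)" "f ` pverts H \<subseteq> pverts G"
    and arcs: "\<And>x y. x \<in> pverts H \<Longrightarrow> y \<in> pverts H \<Longrightarrow> (f x, f y) \<in> parcs G \<longleftrightarrow> (x, y) \<in> parcs H"
  shows "contains G H"
proof -
  interpret G: pair_wf_digraph G by fact
  interpret H: pair_wf_digraph H by fact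
  define G' where "G' = \<lparr>pverts = f ` pverts H, parcs = map_prod f f ` parcs H\<rparr>"
  have wf: "wf_digraph (with_proj G')"
    by unfold_locales (auto simp: G'_def dest: H.in_arcsD1 H.in_arcsD2)
  have parcs: "parcs G' = {e \<in> parcs G. fst e \<in> pverts G' \<and> snd e \<in> pverts G'}"
  proof (intro equalityI subsetI)
    fix e assume "e \<in> parcs G'"
    then obtain x y where "e = (f x, f y)" "(x, y) \<in> parcs H" by (auto simp: G'_def)
    then show "e \<in> {e \<in> parcs G. fst e \<in> pverts G' \<and> snd e \<in> pverts G'}"
      using arcs[of x y] H.in_arcsD1 H.in_arcsD2 by (auto simp: G'_def)
  next
    fix e assume "e \<in> {e \<in> parcs G. fst e \<in> pverts G' \<and> snd e \<in> pverts G'}"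
    then obtain x y where "e = (f x, f y)" "e \<in> parcs G" "x \<in> pverts H" "y \<in> pverts H"
      by (cases e) (auto simp: G'_def)
    then show "e \<in> parcs G'" using arcs[of x y] by (auto simp: G'_def)
  qed
  have "induced_subgraph (with_proj G') (with_proj G)"
    unfolding induced_subgraph_def subgraph_def compatible_def
    using wf G.wf_digraph parcs f(2) by (auto simp: G'_def)
  moreover have "digraph_iso (with_proj H) (with_proj G')"
  proof -
    define h where "h = \<lparr>iso_verts = f, iso_arcs = map_prod f f, iso_head = snd, iso_tail = fst\<rparr>"
    have "parcs H \<subseteq> pverts H \<times> pverts H" using H.in_arcsD1 H.in_arcsD2 by auto
    then have "inj_on (map_prod f f) (parcs H)"
      using map_prod_inj_on[OF f(1) f(1)] by (rule inj_on_subset[rotated])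
    then have "pre_digraph.digraph_isomorphism (with_proj H) h"
      using f(1) H.wf_digraph by (auto simp: pre_digraph.digraph_isomorphism_def h_def)
    moreover have "with_proj G' = app_iso h (with_proj H)"
      by (simp add: with_proj_def app_iso_def G'_def h_def)
    ultimately show ?thesis unfolding digraph_iso_def by blast
  qed
  ultimately show ?thesis unfolding contains_def by blast
qed

text \<open>Converts freeness into the bound on path families. Copy \<open>i\<close> goes to the
  triple at list index \<open>i - 1\<close>, and \<open>w\<close> translates numbers into vertices
  of \<open>G\<close>.\<close>

lemma contains_copies_P3:
  assumes G: "pair_graph G"
    and E: "\<And>u v. u < n \<Longrightarrow> v < n \<Longrightarrow> E u v \<longleftrightarrow> (w u, w v) \<in> parcs G"
    and w: "inj_on w {..<n}" "w ` {..<n} \<subseteq> pverts G"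
    and ts: "P3_family E {..<n} ts" "r \<le> length ts"
  shows "contains G (copies r (path_graph 3))"
proof -
  interpret G: pair_graph G by fact
  have sym: "E u v \<Longrightarrow> E v u" and irr: "\<not> E u u" if "u < n" "v < n" for u v
    using E that G.pair_sym_arcs G.pair_no_loops[of "(w u, w u)"] by (auto simp: symmetric_def sym_def)
  define p where "p x = (case ts ! (fst x - 1) of (a, b, c) \<Rightarrow>
    if snd x = 1 then a else if snd x = 2 then b else c)" for x :: "nat \<times> nat"
  let ?V = "{1..r} \<times> {1..3::nat}"
  have in_t: "ts ! (fst x - 1) \<in> set ts" if "x \<in> ?V" for x
    using that ts(2) by (auto intro!: nth_mem)
  have p_in: "p x \<in> path_verts (ts ! (fst x - 1))" for x
    by (auto simp: p_def path_verts_def split: prod.splits)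
  have p_less: "p x < n" if "x \<in> ?V" for x
    using ts(1) p_in[of x] in_t[OF that] by (auto simp: P3_family_def)
  have anti: "p (i, j) \<noteq> p (i', j') \<and> \<not> E (p (i, j)) (p (i', j'))"
    if "(i, j) \<in> ?V" "(i', j') \<in> ?V" "i < i'" for i j i' j'
  proof -
    have "i - 1 < i' - 1" "i' - 1 < length ts" using that ts(2) by auto
    then have "anticomplete E (path_verts (ts ! (i - 1))) (path_verts (ts ! (i' - 1)))"
      using ts(1) by (auto simp: P3_family_def sorted_wrt_iff_nth_less)
    then show ?thesis using p_in[of "(i, j)"] p_in[of "(i', j')"] by (auto simp: anticomplete_def)
  qed
  have same: "(p (i, j) = p (i, j') \<longleftrightarrow> j = j') \<and>
      (E (p (i, j)) (p (i, j')) \<longleftrightarrow> j' = j + 1 \<or> j = j' + 1)"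
    if "(i, j) \<in> ?V" "(i, j') \<in> ?V" for i j j'
  proof -
    obtain a b c where abc: "ts ! (i - 1) = (a, b, c)" by (metis prod_cases3)
    have "(a, b, c) \<in> set ts" using in_t[OF that(1)] abc by simp
    then have P: "E a b" "E b c" "\<not> E a c" "a \<noteq> c" "a < n" "b < n" "c < n"
      using ts(1) by (auto simp: P3_family_def induced_P3_def path_verts_def)
    then have P': "E b a" "E c b" "\<not> E c a" "a \<noteq> b" "b \<noteq> c" "\<not> E a a" "\<not> E b b" "\<not> E c c"
      using sym irr by blast+
    have p: "p (i, 1) = a" "p (i, 2) = b" "p (i, 3) = c"
      using abc by (simp_all add: p_def)
    have "j = 1 \<or> j = 2 \<or> j = 3" "j' = 1 \<or> j' = 2 \<or> j' = 3" using that by auto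
    then show ?thesis
      by (elim disjE) (simp_all only: p, simp_all add: P P' P(4)[symmetric] P'(4,5)[symmetric])
  qed
  have pE: "(p x = p y \<longleftrightarrow> x = y) \<and> (E (p x) (p y) \<longleftrightarrow>
      fst x = fst y \<and> (snd y = snd x + 1 \<or> snd x = snd y + 1))" if "x \<in> ?V" "y \<in> ?V" for x y
  proof -
    obtain i j i' j' where xy: "x = (i, j)" "y = (i', j')" by fastforce
    consider "i = i'" | "i < i'" | "i' < i" by linarith
    then show ?thesis
    proof cases
      case 1
      then show ?thesis using same[of i j j'] that by (auto simp: xy)
    next
      case 2
      then show ?thesis using anti[of i j i' j'] that by (auto simp: xy)
    next
      case 3
      then show ?thesis using anti[of i' j' i j] that sym[OF p_less p_less, of x y] by (auto simp: xy)
    qed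
  qed
  show ?thesis
  proof (rule containsI)
    show "pair_wf_digraph G" ..
    show "pair_wf_digraph (copies r (path_graph 3))"
      by unfold_locales (auto simp: copies_def path_graph_def)
    have V: "pverts (copies r (path_graph 3)) = ?V" by (simp add: copies_def path_graph_def)
    show "inj_on (w \<circ> p) (pverts (copies r (path_graph 3)))"
      unfolding V using pE p_less w(1) by (intro comp_inj_on) (auto intro!: inj_onI inj_on_subset[OF w(1)])
    show "(w \<circ> p) ` pverts (copies r (path_graph 3)) \<subseteq> pverts G"
      unfolding V using p_less w(2) by auto
    fix x y assume "x \<in> pverts (copies r (path_graph 3))" "y \<in> pverts (copies r (path_graph 3))"
    then have xy: "x \<in> ?V" "y \<in> ?V" by (simp_all add: V)
    have "((w \<circ> p) x, (w \<circ> p) y) \<in> parcs G \<longleftrightarrow> E (p x) (p y)"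
      using E[OF p_less p_less, OF xy] by simp
    also have "\<dots> \<longleftrightarrow> (x, y) \<in> parcs (copies r (path_graph 3))"
      using pE[OF xy] xy by (auto simp: copies_def path_graph_def)
    finally show "((w \<circ> p) x, (w \<circ> p) y) \<in> parcs G \<longleftrightarrow> (x, y) \<in> parcs (copies r (path_graph 3))" .
  qed
qed

section \<open>Reading the input\<close>

text \<open>Written directly for the machine, because it computes the bound that all other loops
  use. The scan ends at the zero behind the unary prefix.\<close>

definition count_vertices :: ram where
  "count_vertices = Seq (SetConst 1 0) (Seq (Read 2 1)
     (WhileNZ 2 (Seq (SetConst 2 1) (Seq (Plus 1 1 2) (Read 2 1)))))"

lemma exec_count_vertices:
  assumes "R 1 = 0" "R 2 = 0" "\<And>i. i < n \<Longrightarrow> M i \<noteq> 0" "M n = 0"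
  shows "exec count_vertices (R, M) (4 * n + 3) (R(1 := n), M)"
proof -
  let ?body = "Seq (SetConst 2 1) (Seq (Plus 1 1 2) (Read 2 1))"
  have loop: "exec (WhileNZ 2 ?body) (R(1 := i, 2 := M i), M) (4 * j + 1) (R(1 := n), M)"
    if "i + j = n" for i j
    using that
  proof (induction j arbitrary: i)
    case 0
    have "R(1 := i, 2 := M i) = R(1 := n)" using 0 assms(2,4) by auto
    moreover have "exec (WhileNZ 2 ?body) (R(1 := n), M) 1 (R(1 := n), M)"
      using assms(2) by (intro exec.WhileFalse) simp
    ultimately show ?case by (metis mult_0_right add_0)
  next
    case (Suc j)
    let ?R = "R(1 := i, 2 := M i)"
    have "exec ?body (?R, M) (1 + (1 + 1)) (?R(2 := 1, 1 := (?R(2 := 1)) 1 + (?R(2 := 1)) 2,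
        2 := M ((?R(2 := 1, 1 := (?R(2 := 1)) 1 + (?R(2 := 1)) 2)) 1)), M)"
      by (rule exec.Seq[OF exec.SetConst exec.Seq[OF exec.Plus exec.Read]])
    moreover have "?R(2 := 1, 1 := (?R(2 := 1)) 1 + (?R(2 := 1)) 2,
        2 := M ((?R(2 := 1, 1 := (?R(2 := 1)) 1 + (?R(2 := 1)) 2)) 1)) = R(1 := Suc i, 2 := M (Suc i))"
      by auto
    ultimately have b: "exec ?body (?R, M) 3 (R(1 := Suc i, 2 := M (Suc i)), M)"
      by (simp add: numeral_3_eq_3)
    have "exec (WhileNZ 2 ?body) (?R, M) (1 + 3 + (4 * j + 1)) (R(1 := n), M)"
      using assms(3)[of i] Suc.prems by (intro exec.WhileTrue[OF _ b Suc.IH]) auto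
    moreover have "1 + 3 + (4 * j + 1) = 4 * Suc j + 1" by simp
    ultimately show ?case by metis
  qed
  have "exec count_vertices (R, M) (1 + (1 + (4 * n + 1))) (R(1 := n), M)"
    unfolding count_vertices_def
    by (rule exec.Seq[OF exec.SetConst exec.Seq[OF exec.Read]]) (use loop[of 0 n] in simp)
  moreover have "1 + (1 + (4 * n + 1)) = 4 * n + 3" by simp
  ultimately show ?thesis by metis
qed

lemma length_concat_map:
  "(\<And>x. x \<in> set xs \<Longrightarrow> length (f x) = m) \<Longrightarrow> length (concat (map f xs)) = length xs * m"
  by (induction xs) auto

lemma nth_concat_map:
  "(\<And>x. x \<in> set xs \<Longrightarrow> length (f x) = m) \<Longrightarrow> i < length xs \<Longrightarrow> j < m \<Longrightarrow>
    concat (map f xs) ! (m * i + j) = f (xs ! i) ! j"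
proof (induction xs arbitrary: i)
  case (Cons x xs)
  show ?case
  proof (cases i)
    case (Suc l)
    then show ?thesis using Cons by (simp add: nth_append add.assoc)
  qed (use Cons.prems in \<open>simp add: nth_append\<close>)
qed simp

lemma encode_nth:
  fixes k :: nat and G :: "nat pair_pre_digraph" and L :: "nat \<Rightarrow> nat set"
  defines "vs \<equiv> sorted_list_of_set (pverts G)"
  defines "n \<equiv> length vs"
  defines "xs \<equiv> encode k (G, L)"
  shows "length xs = n + 1 + n * n + n * k"
    and "\<And>i. i < n \<Longrightarrow> xs ! i" and "\<not> xs ! n"
    and "\<And>u v. u < n \<Longrightarrow> v < n \<Longrightarrow> xs ! (n + 1 + n * u + v) \<longleftrightarrow> (vs ! u, vs ! v) \<in> parcs G"
    and "\<And>v c. v < n \<Longrightarrow> c \<in> {1..k} \<Longrightarrow> xs ! (n + 1 + n * n + (k * v + (c - 1))) \<longleftrightarrow> c \<in> L (vs ! v)"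
proof -
  define As where "As = concat (map (\<lambda>u. map (\<lambda>v. (u, v) \<in> parcs G) vs) vs)"
  define Ls where "Ls = concat (map (\<lambda>v. map (\<lambda>c. c \<in> L v) [1..<k + 1]) vs)"
  have xs: "xs = replicate n True @ [False] @ As @ Ls"
    by (simp add: xs_def encode_def As_def Ls_def vs_def n_def Let_def)
  have As: "length As = n * n" unfolding As_def n_def by (rule length_concat_map) simp
  have Ls: "length Ls = n * k" unfolding Ls_def n_def by (rule length_concat_map) simp
  show "length xs = n + 1 + n * n + n * k" by (simp add: xs As Ls)
  show "xs ! i" if "i < n" for i using that by (simp add: xs nth_append)
  show "\<not> xs ! n" by (simp add: xs nth_append)
  show "xs ! (n + 1 + n * u + v) \<longleftrightarrow> (vs ! u, vs ! v) \<in> parcs G" if "u < n" "v < n" for u v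
  proof -
    have "n * u + v < n * Suc u" using that(2) by simp
    also have "\<dots> \<le> n * n" using that(1) by (intro mult_left_mono) auto
    finally have "xs ! (n + 1 + n * u + v) = As ! (n * u + v)"
      by (simp add: xs nth_append As)
    also have "\<dots> = map (\<lambda>v. (vs ! u, v) \<in> parcs G) vs ! v"
      unfolding As_def by (rule nth_concat_map) (use that in \<open>auto simp: n_def\<close>)
    finally show ?thesis using that(2) by (simp add: n_def)
  qed
  show "xs ! (n + 1 + n * n + (k * v + (c - 1))) \<longleftrightarrow> c \<in> L (vs ! v)" if "v < n" "c \<in> {1..k}" for v c
  proof -
    have "xs ! (n + 1 + n * n + (k * v + (c - 1))) = Ls ! (k * v + (c - 1))"
      by (simp add: xs nth_append As)
    also have "\<dots> = map (\<lambda>c. c \<in> L (vs ! v)) [1..<k + 1] ! (c - 1)"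
      unfolding Ls_def by (rule nth_concat_map) (use that in \<open>auto simp: n_def\<close>)
    also have "\<dots> = (c \<in> L (vs ! v))" using that(2) by (auto simp: nth_map_upt simp del: upt_Suc)
    finally show ?thesis .
  qed
qed

section \<open>Deciding list colorability\<close>

lemma solver_decides:
  fixes k r :: nat
  defines "m \<equiv> 2 * r * k + 3 * r + 1"
  defines "D \<equiv> 11 + guesses k m"
  assumes G: "pair_graph G" and L: "list_assignment k G L"
    and free: "is_free (copies r (path_graph 3)) G"
  shows "\<exists>t R M. exec (Seq count_vertices (comp D (solve k m))) (initial_state (encode k (G, L))) t (R, M) \<and>
    t \<le> poly ([:3, 4:] + cmd_time (solve k m)) (length (encode k (G, L))) \<and>
    (R 0 \<noteq> 0 \<longleftrightarrow> has_list_coloring k (G, L))"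
proof -
  interpret G: pair_graph G by fact
  define xs where "xs = encode k (G, L)"
  define vs where "vs = sorted_list_of_set (pverts G)"
  define n where "n = length vs"
  define inp where "inp i = (if i < length xs \<and> xs ! i then 1 else 0 :: nat)" for i
  \<comment> \<open>Vertices are renumbered by their positions in \<open>vs\<close>. Cutting
    \<open>E\<close> off at \<open>n\<close> makes it symmetric and irreflexive on all numbers, as
    the locale demands.\<close>
  define E where "E u v \<longleftrightarrow> u < n \<and> v < n \<and> (vs ! u, vs ! v) \<in> parcs G" for u v
  note enc = encode_nth[where k = k and G = G and L = L, folded xs_def vs_def n_def]
  have vs: "set vs = pverts G" "distinct vs"
    using G.pair_finite_verts by (simp_all add: vs_def)
  have vin: "vs ! u \<in> pverts G" if "u < n" for u
    using nth_mem[of u vs] that vs(1) unfolding n_def by simp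
  have sym: "(b, a) \<in> parcs G" if "(a, b) \<in> parcs G" for a b
    using G.pair_sym_arcs that unfolding symmetric_def with_proj_simps by (rule symD)
  have Esym: "E v u" if "E u v" for u v using sym that unfolding E_def by blast
  have Eirr: "\<not> E u u" for u using G.pair_no_loops[of "(vs ! u, vs ! u)"] by (auto simp: E_def)
  interpret solver k m n "length xs" inp E "\<lambda>v. L (vs ! v)"
  proof
    show "n + 1 + n * n + n * k \<le> length xs" by (simp add: enc(1))
    show "E u v \<Longrightarrow> E v u" "\<not> E u u" for u v by (rule Esym, assumption, rule Eirr)
    fix u v assume uv: "u < n" "v < n"
    have "n * u + v < n * Suc u" using uv(2) by simp
    also have "\<dots> \<le> n * n" using uv(1) by (intro mult_left_mono) auto
    finally have "n + 1 + n * u + v < length xs" by (simp add: enc(1))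
    then show "inp (n + 1 + n * u + v) \<noteq> 0 \<longleftrightarrow> E u v"
      using enc(4)[OF uv] uv by (auto simp: inp_def E_def)
  next
    fix v c assume vc: "v < n" "c \<in> {1..k}"
    have "k * v + (c - 1) < k * Suc v" using vc(2) by auto
    also have "\<dots> \<le> k * n" using vc(1) by (intro mult_left_mono) auto
    finally have "n + 1 + n * n + (k * v + (c - 1)) < length xs" by (simp add: enc(1) mult.commute)
    then show "inp (n + 1 + n * n + (k * v + (c - 1))) \<noteq> 0 \<longleftrightarrow> c \<in> L (vs ! v)"
      using enc(5)[OF vc] by (auto simp: inp_def)
  qed
  have colorable_iff: "colorable \<longleftrightarrow> has_list_coloring k (G, L)"
  proof
    assume "colorable"
    then obtain \<phi> where \<phi>: "\<And>u. u < n \<Longrightarrow> \<phi> u \<in> L (vs ! u)"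
      "\<And>u v. u < n \<Longrightarrow> v < n \<Longrightarrow> E u v \<Longrightarrow> \<phi> v \<noteq> \<phi> u" unfolding colorable_def by blast
    define ix where "ix v = (SOME i. i < n \<and> vs ! i = v)" for v
    have ix: "ix v < n \<and> vs ! ix v = v" if "v \<in> pverts G" for v
      unfolding ix_def by (rule someI_ex) (use that vs(1) in \<open>auto simp: in_set_conv_nth n_def\<close>)
    have "list_coloring k G L (\<phi> \<circ> ix)"
      unfolding list_coloring_def proper_coloring_def
    proof (intro conjI ballI)
      fix v assume v: "v \<in> pverts G"
      show "(\<phi> \<circ> ix) v \<in> L v" using \<phi>(1)[of "ix v"] ix[OF v] by simp
      then show "(\<phi> \<circ> ix) v \<in> {1..k}" using L v unfolding list_assignment_def by blast
    next
      fix e assume e: "e \<in> parcs G"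
      obtain u v where uv: "e = (u, v)" by fastforce
      then have V: "u \<in> pverts G" "v \<in> pverts G" using e G.in_arcsD1 G.in_arcsD2 by auto
      then have "E (ix v) (ix u)" using sym[of u v] e uv ix by (simp add: E_def)
      then show "case e of (u, v) \<Rightarrow> (\<phi> \<circ> ix) u \<noteq> (\<phi> \<circ> ix) v"
        using \<phi>(2)[of "ix v" "ix u"] ix V by (auto simp: uv)
    qed
    then show "has_list_coloring k (G, L)" by (auto simp: has_list_coloring_def)
  next
    assume "has_list_coloring k (G, L)"
    then obtain \<phi> where \<phi>: "list_coloring k G L \<phi>" by (auto simp: has_list_coloring_def)
    have "\<phi> (vs ! u) \<in> L (vs ! u)" if "u < n" for u
      using \<phi> vin[OF that] by (simp add: list_coloring_def)
    moreover have "\<phi> (vs ! w) \<noteq> \<phi> (vs ! u)" if "E u w" for u w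
    proof -
      have "(vs ! w, vs ! u) \<in> parcs G" using sym that by (simp add: E_def)
      then show ?thesis using \<phi> unfolding list_coloring_def proper_coloring_def by blast
    qed
    ultimately show "colorable"
      unfolding colorable_def by (intro exI[of _ "\<lambda>u. \<phi> (vs ! u)"]) blast
  qed
  have short: "length ts \<le> r" if "P3_family E {..<n} ts" for ts
  proof (rule ccontr)
    assume "\<not> length ts \<le> r"
    then have "contains G (copies r (path_graph 3))"
    proof (intro contains_copies_P3[where w = "(!) vs" and n = n and E = E, OF G _ _ _ that])
      show "inj_on ((!) vs) {..<n}" using vs(2) by (simp add: n_def inj_on_nth)
      show "(!) vs ` {..<n} \<subseteq> pverts G" using vin by blast
    qed (auto simp: E_def)
    then show False using free by simp
  qed
  have ex: "\<exists>g. (\<forall>i. g i < n) \<and> feasible g" if "n > 0" "colorable"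
  proof (rule ex_feasible[OF _ _ short that])
    show "m = 2 * r * k + 3 * r + 1" by (simp add: m_def)
    show "L (vs ! v) \<subseteq> {1..k}" if "v < n" for v
      using L vin[OF that] unfolding list_assignment_def by blast
  qed
  obtain R M where init: "initial_state xs = (R, M)" by fastforce
  have RM: "R 0 = length xs" "R 1 = 0" "R 2 = 0" "M = inp"
    using init by (auto simp: initial_state_def inp_def)
  have nx: "n < length xs" by (simp add: enc(1))
  have c: "exec count_vertices (R, M) (4 * n + 3) (R(1 := n), M)"
    using RM enc(2,3) nx by (intro exec_count_vertices) (auto simp: inp_def)
  obtain t s where s: "exec (comp D (solve k m)) (R(1 := n), M) t s" "t \<le> poly (cmd_time (solve k m)) n"
    "agree D (sem (solve k m) (R(1 := n), M)) s"
  proof -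
    have "cmd_wf D (solve k m)" "1 < D" "agree D (R(1 := n), M) (R(1 := n), M)"
      using wf_solve[of k m] by (simp_all add: D_def agree_def)
    moreover have "fst (R(1 := n), M) 1 = n" by simp
    ultimately show ?thesis using that comp_correct by metis
  qed
  obtain R' M' where s': "s = (R', M')" by fastforce
  have "exec (Seq count_vertices (comp D (solve k m))) (initial_state xs) (4 * n + 3 + t) (R', M')"
    unfolding init using exec.Seq[OF c s(1)] s' by simp
  moreover have "4 * n + 3 + t \<le> poly ([:3, 4:] + cmd_time (solve k m)) (length xs)"
    using s(2) nx poly_nat_mono[of n "length xs" "cmd_time (solve k m)"] by simp
  moreover have "R' 0 \<noteq> 0 \<longleftrightarrow> has_list_coloring k (G, L)"
  proof -
    have "R' 0 = fst (sem (solve k m) (R(1 := n), M)) 0"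
      using s(3) s' by (simp add: agree_def D_def)
    then show ?thesis
      using solve_spec[of "(R(1 := n), M)", OF _ _ _ ex] RM colorable_iff by simp
  qed
  ultimately show ?thesis unfolding xs_def by blast
qed

theorem theorem1p3:
  fixes k r :: nat
  assumes "k \<ge> 1" and "r \<ge> 1"
  shows "list_coloring_poly_time_on_free k (copies r (path_graph 3))"
proof -
  \<comment> \<open>The number of guesses per block depends on \<open>k\<close> and \<open>r\<close>
    alone, so program and polynomial are fixed before the instance.\<close>
  let ?m = "2 * r * k + 3 * r + 1"
  show ?thesis
    unfolding list_coloring_poly_time_on_free_def poly_time_decidable_def list_coloring_instances_def
    by (rule exI[of _ "Seq count_vertices (comp (11 + guesses k ?m) (solve k ?m))"],
        rule exI[of _ "[:3, 4:] + cmd_time (solve k ?m)"])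
      (use solver_decides[of _ k _ r] in blast)
qed

end
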